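(* Let $\mathbb{k}$ be a field of characteristic $0$ and let $n>1$ be an integer. Let $A=\sum_{i=1}^{n}(1,2,\ldots,i)\in\mathbb{k}S_n$ (the top-to-random shuffle), where $(1,2,\ldots,i)$ denotes the cycle $1\mapsto 2\mapsto\cdots\mapsto i\mapsto 1$ (for $i=1$ this is the identity). Let $w_0\in S_n$ be the permutation $w_0(j)=n+1-j$. Then the elements $w_0A$ and $Aw_0$ of $\mathbb{k}S_n$ both have minimal polynomial \[ \prod_{k\in L(n)}(x-k),\qquad L(n):=\{-n+2\}\cup\{k\in\mathbb{Z}: -n+4\le k\le n-3\}\cup\{0\}\cup\{n\} \] (the product over the distinct elements of the set $L(n)$).
   Context: $S_n$ is the symmetric group of $\{1,\ldots,n\}$ with product $(\sigma\tau)(i)=\sigma(\tau(i))$, and $\mathbb{k}S_n$ its group algebra. The minimal polynomial of an element $a$ of a finite-dimensional $\mathbb{k}$-algebra is the monic polynomial of least degree annihilating $a$. *)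

theory Defs
  imports "HOL-Computational_Algebra.Polynomial"
    "HOL-Algebra.Sym_Groups" "HOL-Algebra.Module"
begin

text \<open>
  The group algebra of a \<^emph>\<open>finite\<close> group \<open>G\<close> over a field given as a type: elements are the
  coefficient functions on \<open>G\<close>, extended by \<open>0\<close> outside the carrier, and the product is
  convolution.  (For infinite \<open>G\<close> the sum in the product would be a junk value.)
\<close>

definition group_algebra :: "('g, 'm) monoid_scheme \<Rightarrow> ('k::field, 'g \<Rightarrow> 'k) module"
  where "group_algebra G =
    \<lparr> carrier = {f. \<forall>g. g \<notin> carrier G \<longrightarrow> f g = 0},
      mult = (\<lambda>f h g. \<Sum>(x, y) \<in> {(x, y) \<in> carrier G \<times> carrier G. x \<otimes>\<^bsub>G\<^esub> y = g}. f x * h y),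
      one = (\<lambda>g. if g = \<one>\<^bsub>G\<^esub> then 1 else 0),
      zero = (\<lambda>g. 0),
      add = (\<lambda>f h g. f g + h g),
      smult = (\<lambda>c f g. c * f g) \<rparr>"

definition basis_elem :: "'g \<Rightarrow> 'g \<Rightarrow> 'k::field"
  where "basis_elem g = (\<lambda>x. if x = g then 1 else 0)"

definition alg_eval :: "('k::field, 'a, 'm) module_scheme \<Rightarrow> 'k poly \<Rightarrow> 'a \<Rightarrow> 'a"
  where "alg_eval M p a = (\<Oplus>\<^bsub>M\<^esub>i\<in>{..degree p}. coeff p i \<odot>\<^bsub>M\<^esub> (a [^]\<^bsub>M\<^esub> i))"

definition is_min_poly :: "('k::field, 'a, 'm) module_scheme \<Rightarrow> 'a \<Rightarrow> 'k poly \<Rightarrow> bool"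
  where "is_min_poly M a p \<longleftrightarrow>
    lead_coeff p = 1 \<and> alg_eval M p a = \<zero>\<^bsub>M\<^esub> \<and>
    (\<forall>q. lead_coeff q = 1 \<and> alg_eval M q a = \<zero>\<^bsub>M\<^esub> \<longrightarrow> degree p \<le> degree q)"

text \<open>
  \<^term>\<open>cycle_of_list [1..<Suc i]\<close> is the cycle \<open>1 \<mapsto> 2 \<mapsto> \<dots> \<mapsto> i \<mapsto> 1\<close>.
\<close>

definition top_to_random :: "nat \<Rightarrow> (nat \<Rightarrow> nat) \<Rightarrow> 'k::field"
  where "top_to_random n =
    (\<Oplus>\<^bsub>group_algebra (sym_group n)\<^esub>i\<in>{1..n}. basis_elem (cycle_of_list [1..<Suc i]))"

definition w0 :: "nat \<Rightarrow> nat \<Rightarrow> nat"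
  where "w0 n = (\<lambda>j. if j \<in> {1..n} then n + 1 - j else j)"

definition L :: "nat \<Rightarrow> int set"
  where "L n = {- int n + 2} \<union> {k. - int n + 4 \<le> k \<and> k \<le> int n - 3} \<union> {0} \<union> {int n}"

end

theory Submission
  imports Defs
begin

text \<open>
  Read a permutation \<open>\<sigma>\<close> as the word \<open>\<sigma>\<inverse>(1) \<dots> \<sigma>\<inverse>(n)\<close> in noncommuting letters.  Left multiplication by
  \<open>w\<^sub>0 A\<close> becomes the operator \<open>T f = \<Sum>\<^sub>x R (x \<cdot> \<partial>\<^sub>x f)\<close>, where \<open>R\<close> reverses words and \<open>\<partial>\<^sub>x\<close> is the derivation
  of the free algebra that deletes the letter \<open>x\<close>.  From \<open>\<partial>\<^sub>x T = (T + R) \<partial>\<^sub>x\<close> it follows that on the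
  polynomials killed by all \<open>(k+1)\<close>-fold derivatives, modulo those killed by all \<open>k\<close>-fold ones,
  \<open>T\<close> acts as \<open>k R\<close> acts on \<open>k\<close>-th derivatives; since \<open>R\<^sup>2 = 1\<close>, the eigenvalues on this layer are among
  \<open>k\<close> and \<open>-k\<close>, and distinct layers have distinct eigenvalues.  The \<open>k\<close>-th derivatives in question are
  elements of degree \<open>m = n - k\<close> with vanishing derivatives.  There are none for \<open>m = 1\<close>; \<open>R\<close> acts on them
  as \<open>1\<close>, \<open>-1\<close>, \<open>1\<close> for \<open>m = 0, 2, 3\<close>; both signs occur for \<open>m \<ge> 4\<close>, as commutators and products of
  commutators show.  Finally \<open>A w\<^sub>0\<close> is conjugate to \<open>w\<^sub>0 A\<close> by \<open>w\<^sub>0\<close>.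
\<close>

section \<open>Derivations of words and the reversed shuffle\<close>

text \<open>Polynomials in noncommuting letters are given by their coefficient functions on words, so deleting
  a letter \<open>x\<close> turns into summing over all insertions of \<open>x\<close>.\<close>

fun word_deriv :: "'a \<Rightarrow> ('a list \<Rightarrow> 'k::field) \<Rightarrow> 'a list \<Rightarrow> 'k" where
  "word_deriv x F [] = F [x]"
| "word_deriv x F (a # u) = F (x # a # u) + word_deriv x (\<lambda>v. F (a # v)) u"

text \<open>The operator T: reversal moves the prepended letter to the end, so the last letter of
  \<open>u\<close> is the one by which \<open>F\<close> is differentiated. The empty word gets 0
  because every term of T f contains a letter.\<close>

definition rev_shuffle :: "('a list \<Rightarrow> 'k::field) \<Rightarrow> 'a list \<Rightarrow> 'k" where
  "rev_shuffle F u = (if u = [] then 0 else word_deriv (last u) F (rev (butlast u)))"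

lemma rev_shuffle_simps [simp]:
  "rev_shuffle F [] = 0"
  "rev_shuffle F (u @ [x]) = word_deriv x F (rev u)"
  by (simp_all add: rev_shuffle_def)

lemma word_deriv_eq_sum:
  "word_deriv x F u = (\<Sum>i\<le>length u. F (take i u @ x # drop i u))"
  by (induction u arbitrary: F) (simp_all add: sum.atMost_Suc_shift del: sum.atMost_Suc)

lemma word_deriv_lin:
  "word_deriv x (\<lambda>v. a * F v + b * G v) u = a * word_deriv x F u + b * word_deriv x G u"
  by (simp add: word_deriv_eq_sum sum.distrib sum_distrib_left)

lemma word_deriv_add:
  "word_deriv x (\<lambda>v. F v + G v) u = word_deriv x F u + word_deriv x G u"
  by (simp add: word_deriv_eq_sum sum.distrib)

lemma word_deriv_diff:
  "word_deriv x (\<lambda>v. F v - G v) u = word_deriv x F u - word_deriv x G u"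
  by (simp add: word_deriv_eq_sum sum_subtractf)

lemma word_deriv_scale: "word_deriv x (\<lambda>v. c * F v) u = c * word_deriv x F u"
  by (simp add: word_deriv_eq_sum sum_distrib_left)

lemma word_deriv_zero [simp]: "word_deriv x (\<lambda>v. 0) u = 0"
  by (simp add: word_deriv_eq_sum)

lemma word_deriv_nonzero:
  assumes "word_deriv x F u \<noteq> 0"
  obtains v where "mset v = add_mset x (mset u)" "F v \<noteq> 0"
proof -
  obtain i where "F (take i u @ x # drop i u) \<noteq> 0"
    using assms unfolding word_deriv_eq_sum by (meson sum.neutral)
  moreover have "mset (take i u @ x # drop i u) = add_mset x (mset u)"
    by (metis append_take_drop_id mset_append mset.simps(2) union_mset_add_mset_right)
  ultimately show ?thesis using that by blast
qed

lemma word_deriv_snoc: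
  "word_deriv x F (u @ [y]) = F (u @ [y, x]) + word_deriv x (\<lambda>v. F (v @ [y])) u"
  by (induction u arbitrary: F) (simp_all add: algebra_simps)

lemma word_deriv_rev: "word_deriv x (\<lambda>v. F (rev v)) u = word_deriv x F (rev u)"
  by (induction u arbitrary: F rule: rev_induct) (simp_all add: word_deriv_snoc)

text \<open>Both sides sum \<open>F\<close> over all ways of inserting the two letters
  \<open>x\<close> and \<open>y\<close> into \<open>u\<close>.\<close>

lemma word_deriv_commute:
  "word_deriv x (word_deriv y F) u = word_deriv y (word_deriv x F) u"
  by (induction u arbitrary: F) (simp_all add: word_deriv_add algebra_simps)

text \<open>In \<open>R (y \<cdot> \<partial>\<^sub>y f)\<close> the derivation by \<open>x\<close>
  hits either the prepended letter, which for y = x leaves \<open>R \<partial>\<^sub>x f\<close>, or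
  the factor \<open>\<partial>\<^sub>y f\<close>, with which it commutes.\<close>

lemma word_deriv_rev_shuffle:
  "word_deriv x (rev_shuffle F) u = rev_shuffle (word_deriv x F) u + word_deriv x F (rev u)"
proof (cases u rule: rev_cases)
  case Nil
  have "rev_shuffle F ([] @ [x]) = word_deriv x F []"
    by (simp only: rev_shuffle_simps rev.simps)
  then show ?thesis using Nil by simp
next
  case (snoc v y)
  \<comment> \<open>Inserting \<open>x\<close> behind the last letter gives the extra reversal term;
    all other insertions keep \<open>y\<close> last.\<close>
  have "rev_shuffle F (v @ [y, x]) = word_deriv x F (y # rev v)"
    using rev_shuffle_simps(2)[of F "v @ [y]" x] by simp
  then show ?thesis
    by (simp add: snoc word_deriv_snoc word_deriv_rev word_deriv_commute del: word_deriv.simps)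
qed

lemma rev_shuffle_lin:
  "rev_shuffle (\<lambda>v. a * F v + b * G v) u = a * rev_shuffle F u + b * rev_shuffle G u"
  by (simp add: rev_shuffle_def word_deriv_lin)

lemma rev_shuffle_zero [simp]: "rev_shuffle (\<lambda>v. 0) u = 0"
  by (simp add: rev_shuffle_def)

lemma rev_shuffle_const:
  assumes "\<And>x. word_deriv x F = (\<lambda>_. 0)"
  shows "rev_shuffle F = (\<lambda>_. 0)"
  using assms by (auto simp: rev_shuffle_def)

lemma rev_shuffle_nonzero:
  assumes "rev_shuffle F u \<noteq> 0"
  obtains v where "mset v = mset u" "F v \<noteq> 0"
proof (cases u rule: rev_cases)
  case Nil
  then show ?thesis using assms by simp
next
  case (snoc w x)
  then have "word_deriv x F (rev w) \<noteq> 0" using assms by simp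
  then show ?thesis using that snoc by (elim word_deriv_nonzero) simp
qed

section \<open>The filtration by vanishing of iterated derivatives\<close>

primrec deriv_filt :: "nat \<Rightarrow> ('a list \<Rightarrow> 'k::field) set" where
  "deriv_filt 0 = {\<lambda>_. 0}"
| "deriv_filt (Suc k) = {F. \<forall>x. word_deriv x F \<in> deriv_filt k}"

text \<open>The part of \<open>deriv_filt (Suc k)\<close> whose \<open>k\<close>-th derivatives are
  fixed up to the scalar \<open>e\<close> by reversal. Modulo \<open>deriv_filt k\<close>, T acts on
  it as the scalar \<open>e * k\<close>.\<close>

primrec signed_filt :: "'k \<Rightarrow> nat \<Rightarrow> ('a list \<Rightarrow> 'k::field) set" where
  "signed_filt e 0 = {F. (\<forall>x. word_deriv x F = (\<lambda>_. 0)) \<and> (\<forall>u. F (rev u) = e * F u)}"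
| "signed_filt e (Suc k) = {F. \<forall>x. word_deriv x F \<in> signed_filt e k}"

definition homog :: "nat \<Rightarrow> ('a list \<Rightarrow> 'k::field) set" where
  "homog n = {F. \<forall>u. F u \<noteq> 0 \<longrightarrow> length u = n}"

lemma homog_length: "F \<in> homog n \<Longrightarrow> F u \<noteq> 0 \<Longrightarrow> length u = n"
  by (auto simp: homog_def)

lemma homogD: "F \<in> homog n \<Longrightarrow> length u \<noteq> n \<Longrightarrow> F u = 0"
  by (auto simp: homog_def)

lemma deriv_filt_lin:
  "F \<in> deriv_filt k \<Longrightarrow> G \<in> deriv_filt k \<Longrightarrow> (\<lambda>u. a * F u + b * G u) \<in> deriv_filt k"
proof (induction k arbitrary: F G)
  case (Suc k)
  then show ?case by (simp add: word_deriv_lin[abs_def])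
qed simp

lemma deriv_filt_zero [simp]: "(\<lambda>_. 0) \<in> deriv_filt k"
  by (induction k) (simp_all add: word_deriv_zero[abs_def] del: word_deriv_zero)

text \<open>The induction needs the twisted operators \<open>T + j R\<close>, with \<open>R\<close> the reversal of words,
  because passing a derivation through \<open>T\<close> produces an extra \<open>R\<close>.\<close>

definition twist :: "'k \<Rightarrow> ('a list \<Rightarrow> 'k::field) \<Rightarrow> 'a list \<Rightarrow> 'k" where
  "twist j F u = rev_shuffle F u + j * F (rev u)"

lemma twist_0: "twist 0 F = rev_shuffle F"
  by (simp add: twist_def fun_eq_iff)

lemma word_deriv_twist: "word_deriv x (twist j F) = twist (j + 1) (word_deriv x F)"
proof
  fix u
  have "word_deriv x (twist j F) u = word_deriv x (\<lambda>v. rev_shuffle F v + j * F (rev v)) u"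
    by (simp add: twist_def[abs_def])
  then show "word_deriv x (twist j F) u = twist (j + 1) (word_deriv x F) u"
    by (simp add: word_deriv_add word_deriv_scale word_deriv_rev word_deriv_rev_shuffle twist_def algebra_simps)
qed

lemma twist_deriv_filt: "F \<in> deriv_filt k \<Longrightarrow> twist j F \<in> deriv_filt k"
proof (induction k arbitrary: F j)
  case 0
  then show ?case by (simp add: twist_def fun_eq_iff)
qed (simp add: word_deriv_twist)

lemma rev_shuffle_deriv_filt: "F \<in> deriv_filt k \<Longrightarrow> rev_shuffle F \<in> deriv_filt k"
  using twist_deriv_filt[of F k 0] by (simp add: twist_0)

text \<open>Differentiation turns (k + 1, j) into (k, j + 1) and keeps k + j. This reduces the claim
  to \<open>k = 0\<close>, where T vanishes and R is the scalar \<open>e\<close>.\<close>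

lemma twist_signed_filt:
  "F \<in> signed_filt e k \<Longrightarrow> (\<lambda>u. twist j F u - e * (of_nat k + j) * F u) \<in> deriv_filt k"
proof (induction k arbitrary: F j)
  case 0
  then show ?case by (simp add: twist_def rev_shuffle_const)
next
  case (Suc k)
  show ?case
  proof (simp add: word_deriv_diff[abs_def] word_deriv_scale word_deriv_twist, intro allI)
    fix x
    have "word_deriv x F \<in> signed_filt e k" using Suc.prems by simp
    from Suc.IH[OF this, of "j + 1"]
    show "(\<lambda>u. twist (j + 1) (word_deriv x F) u - e * (1 + of_nat k + j) * word_deriv x F u) \<in> deriv_filt k"
      by (simp add: algebra_simps)
  qed
qed

lemma rev_shuffle_signed_filt:
  "F \<in> signed_filt e k \<Longrightarrow> (\<lambda>u. rev_shuffle F u - e * of_nat k * F u) \<in> deriv_filt k"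
  using twist_signed_filt[of F e k 0] by (simp add: twist_0)

text \<open>The same reduction leads to the joint kernel of the derivations, where T + j R is j R.
  Only that R is an involution is known there, hence the square.\<close>

lemma twist_twist_deriv_filt:
  "F \<in> deriv_filt (Suc k) \<Longrightarrow> (\<lambda>u. twist j (twist j F) u - (of_nat k + j)^2 * F u) \<in> deriv_filt k"
proof (induction k arbitrary: F j)
  case 0
  then have F: "word_deriv x F = (\<lambda>_. 0)" for x by simp
  \<comment> \<open>Reversal preserves the joint kernel of the derivations, so the second
    application of T also gives 0.\<close>
  have "word_deriv x (\<lambda>v. j * F (rev v)) = (\<lambda>_. 0)" for x
    by (simp add: fun_eq_iff word_deriv_scale word_deriv_rev F)
  then have "rev_shuffle (\<lambda>v. j * F (rev v)) = (\<lambda>_. 0)" by (rule rev_shuffle_const)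
  then show ?case
    by (simp add: twist_def[abs_def] rev_shuffle_const F power2_eq_square)
next
  case (Suc k)
  show ?case
  proof (simp only: deriv_filt.simps mem_Collect_eq word_deriv_diff[abs_def] word_deriv_scale word_deriv_twist, intro allI)
    fix x
    have "word_deriv x F \<in> deriv_filt (Suc k)" using Suc.prems by simp
    from Suc.IH[OF this, of "j + 1"]
    show "(\<lambda>u. twist (j + 1) (twist (j + 1) (word_deriv x F)) u - (of_nat (Suc k) + j)^2 * word_deriv x F u) \<in> deriv_filt k"
      by (simp add: algebra_simps)
  qed
qed

lemma rev_shuffle_twice_deriv_filt:
  assumes "F \<in> deriv_filt (Suc k)"
  shows "(\<lambda>u. rev_shuffle (rev_shuffle F) u - (of_nat k)^2 * F u) \<in> deriv_filt k"
  using twist_twist_deriv_filt[OF assms, of 0] by (simp add: twist_0)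

section \<open>Homogeneous polynomials and the joint kernel in low degrees\<close>

lemma homog_word_deriv:
  assumes "F \<in> homog (Suc n)"
  shows "word_deriv x F \<in> homog n"
  unfolding homog_def
proof (intro CollectI allI impI)
  fix u
  assume "word_deriv x F u \<noteq> 0"
  then obtain v where "mset v = add_mset x (mset u)" "F v \<noteq> 0" by (rule word_deriv_nonzero)
  then show "length u = n"
    using homog_length[OF assms, of v] by (metis size_mset size_add_mset nat.inject)
qed

lemma homog_0_word_deriv:
  assumes "F \<in> homog 0"
  shows "word_deriv x F = (\<lambda>_. 0)"
proof (rule ccontr)
  assume "word_deriv x F \<noteq> (\<lambda>_. 0)"
  then obtain u where "word_deriv x F u \<noteq> 0" by auto
  then obtain v where "mset v = add_mset x (mset u)" "F v \<noteq> 0" by (rule word_deriv_nonzero)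
  then show False using homog_length[OF assms, of v] by auto
qed

lemma homog_rev_shuffle:
  assumes "F \<in> homog n"
  shows "rev_shuffle F \<in> homog n"
  unfolding homog_def
proof (intro CollectI allI impI)
  fix u
  assume "rev_shuffle F u \<noteq> 0"
  then obtain v where "mset v = mset u" "F v \<noteq> 0" by (rule rev_shuffle_nonzero)
  then show "length u = n"
    using homog_length[OF assms, of v] mset_eq_length by metis
qed

lemma homog_lin:
  assumes "F \<in> homog n" "G \<in> homog n"
  shows "(\<lambda>u. a * F u + b * G u) \<in> homog n"
  unfolding homog_def
proof (intro CollectI allI impI)
  fix u
  assume "a * F u + b * G u \<noteq> 0"
  then have "F u \<noteq> 0 \<or> G u \<noteq> 0" by auto
  then show "length u = n" using assms by (auto dest: homog_length)
qed

lemma homog_deriv_filt: "F \<in> homog n \<Longrightarrow> F \<in> deriv_filt (Suc n)"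
  by (induction n arbitrary: F) (auto simp: homog_0_word_deriv homog_word_deriv simp del: word_deriv.simps)

text \<open>The \<open>k\<close>-th derivatives of \<open>F\<close> have degree \<open>m\<close> and
  vanishing derivatives, so the sign on the whole layer is decided by the joint kernel in degree
  \<open>m\<close>.\<close>

lemma homog_deriv_filt_signed:
  assumes "\<And>G :: 'a list \<Rightarrow> 'k::field. G \<in> homog m \<Longrightarrow> (\<And>x. word_deriv x G = (\<lambda>_. 0))
      \<Longrightarrow> (\<And>u. G (rev u) = e * G u)"
  shows "(F :: 'a list \<Rightarrow> 'k) \<in> homog (k + m) \<Longrightarrow> F \<in> deriv_filt (Suc k) \<Longrightarrow> F \<in> signed_filt e k"
proof (induction k arbitrary: F)
  case 0
  then show ?case using assms by simp
next
  case (Suc k)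
  then show ?case by (auto intro: homog_word_deriv)
qed

lemma homog_deriv_filt_signed_0:
  fixes F :: "'a list \<Rightarrow> 'k::field"
  assumes "F \<in> homog k" "F \<in> deriv_filt (Suc k)"
  shows "F \<in> signed_filt 1 k"
proof (rule homog_deriv_filt_signed)
  show "G (rev u) = 1 * G u" if "G \<in> homog 0" for G :: "'a list \<Rightarrow> 'k" and u
    using homogD[OF that] by (cases "u = []") simp_all
qed (use assms in simp_all)

lemma homog_deriv_filt_signed_2:
  fixes F :: "'a list \<Rightarrow> 'k::field"
  assumes "F \<in> homog (k + 2)" "F \<in> deriv_filt (Suc k)"
  shows "F \<in> signed_filt (-1) k"
proof (rule homog_deriv_filt_signed[OF _ assms])
  fix G :: "'a list \<Rightarrow> 'k" and u
  assume G: "G \<in> homog 2" and D: "\<And>x. word_deriv x G = (\<lambda>_. 0)"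
  show "G (rev u) = - 1 * G u"
  proof (cases "length u = 2")
    case True
    then obtain x y where u: "u = [x, y]" by (auto simp: numeral_2_eq_2 length_Suc_conv)
    \<comment> \<open>This coefficient is G[x, y] + G[y, x], so \<open>G\<close> is
      antisymmetric.\<close>
    have "word_deriv x G [y] = 0" by (simp add: D)
    then show ?thesis using u by (simp add: add_eq_0_iff)
  next
    case False
    then show ?thesis using G by (simp add: homogD)
  qed
qed

lemma homog_deriv_filt_signed_3:
  fixes F :: "'a list \<Rightarrow> 'k::field"
  assumes "F \<in> homog (k + 3)" "F \<in> deriv_filt (Suc k)"
  shows "F \<in> signed_filt 1 k"
proof (rule homog_deriv_filt_signed[OF _ assms])
  fix G :: "'a list \<Rightarrow> 'k" and u
  assume G: "G \<in> homog 3" and D: "\<And>x. word_deriv x G = (\<lambda>_. 0)"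
  show "G (rev u) = 1 * G u"
  proof (cases "length u = 3")
    case True
    then obtain x y z where u: "u = [x, y, z]" by (auto simp: numeral_3_eq_3 length_Suc_conv)
    \<comment> \<open>Both derivatives contain the words [y, x, z] and [y, z, x]; subtracting leaves
      the word and its reversal.\<close>
    have "word_deriv x G [y, z] = 0" "word_deriv z G [y, x] = 0" by (simp_all only: D)
    then have "G [x, y, z] + (G [y, x, z] + G [y, z, x]) = G [z, y, x] + (G [y, z, x] + G [y, x, z])"
      by simp
    then show ?thesis using u by (simp add: algebra_simps)
  next
    case False
    then show ?thesis using G by (simp add: homogD)
  qed
qed

text \<open>A linear polynomial with vanishing derivatives is 0, since its derivative by
  \<open>x\<close> is its coefficient at \<open>x\<close>. This is why n - 1 and 1 - n are missing
  from \<open>L n\<close>.\<close>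

lemma homog_deriv_filt_1:
  "F \<in> homog (Suc k) \<Longrightarrow> F \<in> deriv_filt (Suc k) \<Longrightarrow> F \<in> deriv_filt k"
proof (induction k arbitrary: F)
  case 0
  have "F u = 0" for u
  proof (cases "length u = 1")
    case True
    then obtain x where u: "u = [x]" by (auto simp: length_Suc_conv)
    have "word_deriv x F [] = 0" using 0 by (simp del: word_deriv.simps)
    then show ?thesis using u by simp
  next
    case False
    then show ?thesis using 0 by (simp add: homogD)
  qed
  then show ?case by auto
qed (auto intro: homog_word_deriv)

section \<open>The annihilating polynomial\<close>

definition shuffle_eval :: "'k poly \<Rightarrow> ('a list \<Rightarrow> 'k::field) \<Rightarrow> 'a list \<Rightarrow> 'k" where
  "shuffle_eval p F u = (\<Sum>i\<le>degree p. coeff p i * (rev_shuffle ^^ i) F u)"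

text \<open>Padding with zero coefficients gives several polynomials a common summation
  bound.\<close>

lemma shuffle_eval_bound:
  assumes "degree p \<le> N"
  shows "shuffle_eval p F u = (\<Sum>i\<le>N. coeff p i * (rev_shuffle ^^ i) F u)"
  unfolding shuffle_eval_def
  by (rule sum.mono_neutral_left) (use assms in \<open>auto simp: coeff_eq_0\<close>)

lemma shuffle_eval_0 [simp]: "shuffle_eval 0 F = (\<lambda>_. 0)"
  by (simp add: shuffle_eval_def fun_eq_iff)

lemma shuffle_eval_pCons:
  "shuffle_eval (pCons c p) F = (\<lambda>u. c * F u + shuffle_eval p (rev_shuffle F) u)"
proof
  fix u
  have "shuffle_eval (pCons c p) F u
      = (\<Sum>i\<le>Suc (degree p). coeff (pCons c p) i * (rev_shuffle ^^ i) F u)"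
    by (rule shuffle_eval_bound) (simp add: degree_pCons_le)
  then show "shuffle_eval (pCons c p) F u = c * F u + shuffle_eval p (rev_shuffle F) u"
    by (simp add: sum.atMost_Suc_shift shuffle_eval_def funpow_swap1 del: sum.atMost_Suc)
qed

lemma shuffle_eval_1 [simp]: "shuffle_eval 1 F = F"
  by (simp add: one_pCons shuffle_eval_pCons)

lemma shuffle_eval_linear_factor:
  "shuffle_eval [:- c, 1:] F = (\<lambda>u. rev_shuffle F u - c * F u)"
  by (simp add: shuffle_eval_pCons)

lemma shuffle_eval_add: "shuffle_eval (p + q) F u = shuffle_eval p F u + shuffle_eval q F u"
proof -
  let ?N = "max (degree p) (degree q)"
  have "degree (p + q) \<le> ?N" by (rule degree_add_le_max)
  then show ?thesis
    by (simp add: shuffle_eval_bound[of _ ?N] sum.distrib distrib_right)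
qed

lemma shuffle_eval_smult: "shuffle_eval (Polynomial.smult c p) F u = c * shuffle_eval p F u"
proof -
  have "degree (Polynomial.smult c p) \<le> degree p" by (rule degree_smult_le)
  then show ?thesis
    by (simp add: shuffle_eval_bound[of _ "degree p"] sum_distrib_left mult.assoc)
qed

lemma rev_shuffle_shuffle_eval:
  "rev_shuffle (shuffle_eval p F) = shuffle_eval p (rev_shuffle F)"
proof (induction p arbitrary: F)
  case (pCons c p)
  then show ?case
    using rev_shuffle_lin[of c F 1 "shuffle_eval p (rev_shuffle F)"]
    by (simp add: shuffle_eval_pCons fun_eq_iff)
qed (simp add: fun_eq_iff)

lemma shuffle_eval_mult: "shuffle_eval (p * q) F = shuffle_eval p (shuffle_eval q F)"
proof (induction p arbitrary: F)
  case (pCons c p)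
  then show ?case
    by (simp add: fun_eq_iff shuffle_eval_pCons shuffle_eval_add shuffle_eval_smult
        rev_shuffle_shuffle_eval)
qed simp

text \<open>Modulo \<open>deriv_filt k\<close>, the element \<open>F\<close> is an eigenvector of T
  for \<open>e * k\<close>. As T preserves \<open>deriv_filt k\<close>, p(T) acts on this class as
  the value of \<open>p\<close> there.\<close>

lemma shuffle_eval_signed_filt:
  assumes "F \<in> signed_filt e k"
  shows "(\<lambda>u. shuffle_eval p F u - poly p (e * of_nat k) * F u) \<in> deriv_filt k"
proof (induction p)
  case 0
  then show ?case by simp
next
  case (pCons c p)
  let ?G = "\<lambda>u. shuffle_eval p F u - poly p (e * of_nat k) * F u"
  \<comment> \<open>T applied to the induction hypothesis, plus a multiple of the eigenvector
    relation.\<close>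
  have "(\<lambda>u. 1 * rev_shuffle ?G u
      + poly p (e * of_nat k) * (rev_shuffle F u - e * of_nat k * F u)) \<in> deriv_filt k"
    by (intro deriv_filt_lin rev_shuffle_deriv_filt rev_shuffle_signed_filt assms pCons.IH)
  moreover have "rev_shuffle ?G u = shuffle_eval p (rev_shuffle F) u - poly p (e * of_nat k) * rev_shuffle F u" for u
    using rev_shuffle_lin[of 1 "shuffle_eval p F" "- poly p (e * of_nat k)" F u]
    by (simp add: rev_shuffle_shuffle_eval)
  ultimately show ?case
    by (simp add: shuffle_eval_pCons algebra_simps)
qed

text \<open>The eigenvalues contributed by the \<open>j\<close>-th layer of the filtration in degree \<open>n\<close>.\<close>

definition layer_spec :: "nat \<Rightarrow> nat \<Rightarrow> int set" where
  "layer_spec n j =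
    (if j = n then {int n} else if j + 1 = n then {} else if j + 2 = n then {- int j}
     else if j + 3 = n then {int j} else {int j, - int j})"

lemma finite_layer_spec [simp]: "finite (layer_spec n j)"
  by (simp add: layer_spec_def)

text \<open>From the top, the layers give n, nothing, -(n - 2), n - 3, and then both signs. For n =
  1 the value 0 would come from no layer, since layer 0 would be the empty one.\<close>

lemma L_eq_layers:
  assumes "n > 1"
  shows "L n = (\<Union>j\<le>n. layer_spec n j)"
proof (intro equalityI subsetI)
  fix k assume "k \<in> L n"
  \<comment> \<open>Layer \<open>j\<close> contributes only \<open>j\<close> and \<open>- j\<close>,
    so the layer of \<open>k\<close> must be its absolute value.\<close>
  then have "k \<in> layer_spec n (nat \<bar>k\<bar>)" "nat \<bar>k\<bar> \<le> n"
    using assms unfolding L_def layer_spec_def by (auto split: if_splits)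
  then show "k \<in> (\<Union>j\<le>n. layer_spec n j)" by blast
next
  fix k assume "k \<in> (\<Union>j\<le>n. layer_spec n j)"
  then show "k \<in> L n" unfolding L_def layer_spec_def by (auto split: if_splits)
qed

lemma layer_spec_disjoint: "i \<noteq> j \<Longrightarrow> layer_spec n i \<inter> layer_spec n j = {}"
  by (auto simp: layer_spec_def split: if_splits)

lemma shuffle_eval_homog:
  assumes "F \<in> homog n" 
  shows "shuffle_eval p F \<in> homog n"
  using assms
proof (induction p arbitrary: F)
  case 0
  then show ?case by (simp add: homog_def)
next
  case (pCons c p)
  then show ?case
    using homog_lin[of F n "shuffle_eval p (rev_shuffle F)" c 1]
    by (simp add: shuffle_eval_pCons homog_rev_shuffle)
qed

text \<open>The cases follow n - j, the degree of the \<open>j\<close>-th derivatives: in degrees 0,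
  2 and 3 the sign is known, in degree 1 the layer is empty, and from degree 4 on the square
  relation is used.\<close>

lemma shuffle_eval_layer:
  fixes F :: "'a list \<Rightarrow> 'k::field_char_0"
  assumes F: "F \<in> homog n" "F \<in> deriv_filt (Suc j)" and j: "j \<le> n"
  shows "shuffle_eval (\<Prod>k\<in>layer_spec n j. [:- of_int k, 1:]) F \<in> deriv_filt j"
proof -
  have signed: "shuffle_eval [:- (e * of_nat j), 1:] F \<in> deriv_filt j" if "F \<in> signed_filt e j" for e
    using rev_shuffle_signed_filt[OF that] unfolding shuffle_eval_linear_factor .
  consider "n = j" | "n = Suc j" | "n = j + 2" | "n = j + 3" | "n \<ge> j + 4" "j = 0" | "n \<ge> j + 4" "j > 0"
    using j by linarith
  then show ?thesis
  proof cases
    case 1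
    then have "F \<in> signed_filt 1 j" using F homog_deriv_filt_signed_0 by blast
    then show ?thesis using signed[of 1] 1 by (simp add: layer_spec_def)
  next
    case 2
    then show ?thesis using F homog_deriv_filt_1 by (simp add: layer_spec_def)
  next
    case 3
    then have "F \<in> signed_filt (-1) j" using F homog_deriv_filt_signed_2 by blast
    then show ?thesis using signed[of "-1"] 3 by (simp add: layer_spec_def)
  next
    case 4
    then have "F \<in> signed_filt 1 j" using F homog_deriv_filt_signed_3 by blast
    then show ?thesis using signed[of 1] 4 by (simp add: layer_spec_def)
  next
    case 5
    \<comment> \<open>The values \<open>j\<close> and \<open>- j\<close> coincide here, so a single
      factor x remains and T itself must vanish.\<close>
    then have "rev_shuffle F = (\<lambda>_. 0)" using F by (intro rev_shuffle_const) simp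
    then show ?thesis using 5 by (simp add: layer_spec_def shuffle_eval_pCons)
  next
    case 6
    then have "layer_spec n j = {int j, - int j}" "int j \<noteq> - int j" by (simp_all add: layer_spec_def)
    then have "(\<Prod>k\<in>layer_spec n j. [:- of_int k, 1:]) = ([:- ((of_nat j)^2), 0, 1:] :: 'k poly)"
      by (simp add: power2_eq_square)
    then show ?thesis
      using rev_shuffle_twice_deriv_filt[OF F(2)] by (simp add: shuffle_eval_pCons)
  qed
qed

text \<open>The factors are applied from the top layer downwards, each lowering the filtration index
  by one until \<open>deriv_filt 0\<close> is reached.\<close>

lemma shuffle_eval_layers:
  fixes F :: "'a list \<Rightarrow> 'k::field_char_0"
  assumes "F \<in> homog n" "F \<in> deriv_filt k" "k \<le> Suc n"
  shows "shuffle_eval (\<Prod>j<k. \<Prod>k\<in>layer_spec n j. [:- of_int k, 1:]) F = (\<lambda>_. 0)"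
  using assms
proof (induction k arbitrary: F)
  case (Suc k)
  let ?G = "shuffle_eval (\<Prod>i\<in>layer_spec n k. [:- of_int i, 1:]) F"
  have "?G \<in> homog n" "?G \<in> deriv_filt k"
    using Suc.prems by (auto intro: shuffle_eval_homog shuffle_eval_layer)
  then show ?case using Suc.IH[of ?G] Suc.prems by (simp add: shuffle_eval_mult)
qed simp

lemma shuffle_eval_L:
  fixes F :: "'a list \<Rightarrow> 'k::field_char_0"
  assumes "n > 1" "F \<in> homog n"
  shows "shuffle_eval (\<Prod>k\<in>L n. [:- of_int k, 1:]) F = (\<lambda>_. 0)"
proof -
  have "(\<Prod>k\<in>L n. [:- of_int k, 1 :: 'k:]) = (\<Prod>j\<le>n. \<Prod>k\<in>layer_spec n j. [:- of_int k, 1:])"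
    unfolding L_eq_layers[OF assms(1)]
    by (rule prod.UNION_disjoint) (auto dest: layer_spec_disjoint)
  then show ?thesis
    using shuffle_eval_layers[OF assms(2) homog_deriv_filt[OF assms(2)]]
    by (simp add: lessThan_Suc_atMost)
qed

section \<open>Eigenvectors modulo the filtration\<close>

fun lconc :: "'a \<Rightarrow> ('a list \<Rightarrow> 'k::field) \<Rightarrow> 'a list \<Rightarrow> 'k" where
  "lconc y F [] = 0"
| "lconc y F (a # u) = (if a = y then F u else 0)"

text \<open>Right multiplication by the letter \<open>y\<close>, expressed through left
  multiplication and reversal so that its rules are inherited from \<open>lconc\<close>.\<close>

definition rconc :: "'a \<Rightarrow> ('a list \<Rightarrow> 'k::field) \<Rightarrow> 'a list \<Rightarrow> 'k" where
  "rconc y F u = lconc y (\<lambda>v. F (rev v)) (rev u)"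

lemma rconc_simps [simp]:
  "rconc y F [] = 0"
  "rconc y F (u @ [a]) = (if a = y then F u else 0)"
  by (simp_all add: rconc_def)

lemma rconc_last: "last u \<noteq> y \<Longrightarrow> rconc y F u = 0"
  by (cases u rule: rev_cases) simp_all

text \<open>The Leibniz rule for the product of the letter \<open>y\<close> with
  \<open>F\<close>.\<close>

lemma word_deriv_lconc:
  "word_deriv x (lconc y F) u = (if x = y then F u else 0) + lconc y (word_deriv x F) u"
  by (cases u) auto

lemma word_deriv_rconc:
  "word_deriv x (rconc y F) u = (if x = y then F u else 0) + rconc y (word_deriv x F) u"
  using word_deriv_rev[of x "lconc y (\<lambda>v. F (rev v))" u]
  by (simp add: rconc_def[abs_def] word_deriv_lconc word_deriv_rev[abs_def])

lemma lconc_zero [simp]: "lconc y (\<lambda>_. 0) u = 0"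
  by (cases u) auto

lemma rconc_zero [simp]: "rconc y (\<lambda>_. 0) u = 0"
  by (simp add: rconc_def)

lemma lconc_scale: "lconc y (\<lambda>v. c * F v) u = c * lconc y F u"
  by (cases u) auto

lemma rconc_scale: "rconc y (\<lambda>v. c * F v) u = c * rconc y F u"
  by (simp add: rconc_def lconc_scale)

lemma lconc_rev: "lconc y F (rev u) = rconc y (\<lambda>v. F (rev v)) u"
  by (simp add: rconc_def)

lemma rconc_rev: "rconc y F (rev u) = lconc y (\<lambda>v. F (rev v)) u"
  by (simp add: rconc_def)

definition comm1 :: "'a \<Rightarrow> ('a list \<Rightarrow> 'k::field) \<Rightarrow> 'a list \<Rightarrow> 'k" where
  "comm1 y F u = lconc y F u - rconc y F u"

text \<open>Two commutators preserve the sign under reversal, whereas the anticommutator with \<open>ab - ba\<close>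
  flips it.\<close>

definition acomm2 :: "'a \<Rightarrow> 'a \<Rightarrow> ('a list \<Rightarrow> 'k::field) \<Rightarrow> 'a list \<Rightarrow> 'k" where
  "acomm2 a b F u = lconc a (lconc b F) u - lconc b (lconc a F) u
     + rconc b (rconc a F) u - rconc a (rconc b F) u"

text \<open>In the derivative of y F - F y the two copies of F cancel. Reversal takes y F to e F y
  and F y to e y F.\<close>

lemma comm1_signed_filt:
  assumes "F \<in> signed_filt e 0"
  shows "comm1 y F \<in> signed_filt (- e) 0"
proof -
  have F: "word_deriv x F = (\<lambda>_. 0)" "F (rev u) = e * F u" for x u using assms by auto
  show ?thesis
    by (simp add: comm1_def[abs_def] fun_eq_iff word_deriv_diff word_deriv_lconc word_deriv_rconc F
        lconc_rev rconc_rev lconc_scale rconc_scale algebra_simps)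
qed

text \<open>The derivatives of a b F are symmetric in \<open>a\<close> and \<open>b\<close>, and so
  are those of F a b, so each difference is killed. Reversal takes a b F to e F b a, which occurs
  with the opposite sign.\<close>

lemma acomm2_signed_filt:
  assumes "F \<in> signed_filt e 0"
  shows "acomm2 a b F \<in> signed_filt (- e) 0"
proof -
  have F: "word_deriv x F = (\<lambda>_. 0)" "F (rev u) = e * F u" for x u using assms by auto
  have "word_deriv x (lconc a (lconc b F)) u
      = (if x = a then lconc b F u else 0) + (if x = b then lconc a F u else 0)" for x a b u
    by (simp add: word_deriv_lconc F word_deriv_lconc[abs_def])
  moreover have "word_deriv x (rconc a (rconc b F)) u
      = (if x = a then rconc b F u else 0) + (if x = b then rconc a F u else 0)" for x a b u
    by (simp add: word_deriv_rconc F word_deriv_rconc[abs_def])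
  ultimately show ?thesis
    by (simp add: acomm2_def[abs_def] fun_eq_iff word_deriv_diff word_deriv_add F
        lconc_rev rconc_rev lconc_scale rconc_scale algebra_simps)
qed

lemma signed_filt_add:
  "F \<in> signed_filt e k \<Longrightarrow> G \<in> signed_filt e k \<Longrightarrow> (\<lambda>u. F u + G u) \<in> signed_filt e k"
  by (induction k arbitrary: F G)
    (simp_all add: word_deriv_add[abs_def] word_deriv_add distrib_left fun_eq_iff)

lemma signed_filt_zero [simp]: "(\<lambda>_. 0) \<in> signed_filt e k"
  by (induction k) (simp_all add: word_deriv_zero[abs_def] fun_eq_iff del: word_deriv_zero)

lemma signed_filt_if_zero: "F \<in> signed_filt e k \<Longrightarrow> (\<lambda>u. if b then F u else 0) \<in> signed_filt e k"
  by (cases b) (simp_all del: signed_filt.simps)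

text \<open>By the Leibniz rule a derivative of y F is y times a derivative of F, plus F itself when
  the letters agree. Left multiplication thus raises the layer and keeps the sign.\<close>

lemma lconc_signed_filt: "F \<in> signed_filt e k \<Longrightarrow> lconc y F \<in> signed_filt e (Suc k)"
proof (induction k arbitrary: F)
  case 0
  then have F: "word_deriv x F = (\<lambda>_. 0)" for x by simp
  have "word_deriv x (lconc y F) = (\<lambda>u. if x = y then F u else 0)" for x
  proof
    fix u
    show "word_deriv x (lconc y F) u = (if x = y then F u else 0)"
      by (simp add: word_deriv_lconc F)
  qed
  then show ?case
    using signed_filt_if_zero[OF 0] by (simp only: signed_filt.simps(2) mem_Collect_eq simp_thms)
next
  case (Suc k)
  have "word_deriv x (lconc y F) = (\<lambda>u. (if x = y then F u else 0) + lconc y (word_deriv x F) u)" for x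
    by (simp add: fun_eq_iff word_deriv_lconc)
  moreover have "lconc y (word_deriv x F) \<in> signed_filt e (Suc k)" for x
    using Suc by simp
  ultimately have "word_deriv x (lconc y F) \<in> signed_filt e (Suc k)" for x
    using signed_filt_add[OF signed_filt_if_zero[OF Suc.prems]] by (simp only:)
  then show ?case
    by (simp only: signed_filt.simps(2)[of e "Suc k"] mem_Collect_eq simp_thms)
qed

section \<open>Multihomogeneous polynomials\<close>

text \<open>Fixing the multiset of letters, not just the degree, expresses multilinearity and the
  absence of a letter.\<close>

definition homog_content :: "'a multiset \<Rightarrow> ('a list \<Rightarrow> 'k::field) set" where
  "homog_content M = {F. \<forall>u. F u \<noteq> 0 \<longrightarrow> mset u = M}"

lemma homog_content_lconc: "F \<in> homog_content M \<Longrightarrow> lconc y F \<in> homog_content (add_mset y M)"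
  unfolding homog_content_def
proof (intro CollectI allI impI)
  fix u
  assume "F \<in> {F. \<forall>u. F u \<noteq> 0 \<longrightarrow> mset u = M}" "lconc y F u \<noteq> 0"
  then show "mset u = add_mset y M" by (cases u) (auto split: if_splits)
qed

lemma homog_contentD: "F \<in> homog_content M \<Longrightarrow> mset u \<noteq> M \<Longrightarrow> F u = 0"
  by (auto simp: homog_content_def)

lemma homog_contentI: "(\<And>u. mset u \<noteq> M \<Longrightarrow> F u = 0) \<Longrightarrow> F \<in> homog_content M"
  by (auto simp: homog_content_def)

lemma homog_content_rev: "F \<in> homog_content M \<Longrightarrow> (\<lambda>u. F (rev u)) \<in> homog_content M"
  by (rule homog_contentI) (simp add: homog_contentD)

lemma homog_content_rconc:
  assumes "F \<in> homog_content M"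
  shows "rconc y F \<in> homog_content (add_mset y M)"
  unfolding rconc_def[abs_def] by (intro homog_content_rev homog_content_lconc assms)

lemma homog_content_add:
  "F \<in> homog_content M \<Longrightarrow> G \<in> homog_content M \<Longrightarrow> (\<lambda>u. F u + G u) \<in> homog_content M"
  by (rule homog_contentI) (simp add: homog_contentD)

lemma homog_content_diff:
  "F \<in> homog_content M \<Longrightarrow> G \<in> homog_content M \<Longrightarrow> (\<lambda>u. F u - G u) \<in> homog_content M"
  by (rule homog_contentI) (simp add: homog_contentD)

lemma homog_content_comm1:
  assumes "F \<in> homog_content M"
  shows "comm1 y F \<in> homog_content (add_mset y M)"
  unfolding comm1_def[abs_def]
  by (rule homog_content_diff[OF homog_content_lconc[OF assms] homog_content_rconc[OF assms]])

lemma homog_content_acomm2: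
  assumes "F \<in> homog_content M"
  shows "acomm2 a b F \<in> homog_content (add_mset a (add_mset b M))"
proof -
  have l: "lconc x (lconc y F) \<in> homog_content (add_mset x (add_mset y M))" for x y
    by (rule homog_content_lconc[OF homog_content_lconc[OF assms]])
  have r: "rconc x (rconc y F) \<in> homog_content (add_mset x (add_mset y M))" for x y
    by (rule homog_content_rconc[OF homog_content_rconc[OF assms]])
  have c: "add_mset a (add_mset b M) = add_mset b (add_mset a M)" by (rule add_mset_commute)
  show ?thesis
    unfolding acomm2_def[abs_def]
    using homog_content_diff[OF homog_content_add[OF homog_content_diff[OF l[of a b] l[of b a, folded c]]
          r[of b a, folded c]] r[of a b]] .
qed

lemma homog_content_word_deriv_zero:
  assumes "F \<in> homog_content M" "y \<notin># M"
  shows "word_deriv y F = (\<lambda>_. 0)"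
proof (rule ccontr)
  assume "word_deriv y F \<noteq> (\<lambda>_. 0)"
  then obtain u where "word_deriv y F u \<noteq> 0" by auto
  then obtain v where v: "mset v = add_mset y (mset u)" "F v \<noteq> 0" by (rule word_deriv_nonzero)
  then have "mset v \<noteq> M" using assms(2) by auto
  then show False using homog_contentD[OF assms(1)] v(2) by blast
qed

text \<open>For a fresh letter \<open>y\<close> the derivative of y F by \<open>y\<close> is F, so a
  nonzero class stays nonzero one layer higher.\<close>

lemma lconc_notin_deriv_filt:
  assumes "F \<in> homog_content M" "y \<notin># M" "F \<notin> deriv_filt k"
  shows "lconc y F \<notin> deriv_filt (Suc k)"
proof
  assume "lconc y F \<in> deriv_filt (Suc k)"
  then have "word_deriv y (lconc y F) \<in> deriv_filt k" by simp
  moreover have "word_deriv y (lconc y F) = F"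
  proof
    fix u
    show "word_deriv y (lconc y F) u = F u"
      by (simp add: word_deriv_lconc homog_content_word_deriv_zero[OF assms(1,2)])
  qed
  ultimately show False using assms(3) by simp
qed

section \<open>Explicit eigenvectors\<close>

text \<open>Used twice: its multiset describes multilinearity in the letters 1, ..., n, and the word
  itself is where coefficients are tested to be nonzero.\<close>

primrec descending :: "nat \<Rightarrow> nat list" where
  "descending 0 = []"
| "descending (Suc n) = Suc n # descending n"

lemma last_descending: "last (descending (Suc n)) = 1"
  by (induction n) auto

lemma set_descending: "set (descending n) = {1..n}"
  by (induction n) auto

text \<open>The bracket [m + 1, [m, ... [2, 1] ... ]]. The index counts brackets, so m + 1 letters
  occur.\<close>

primrec nested_comm :: "nat \<Rightarrow> nat list \<Rightarrow> 'k::field" where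
  "nested_comm 0 = (\<lambda>u. if u = [1] then 1 else 0)"
| "nested_comm (Suc m) = comm1 (Suc (Suc m)) (nested_comm m)"

lemma nested_comm_homog_content: "nested_comm m \<in> homog_content (mset (descending (Suc m)))"
proof (induction m)
  case 0
  then show ?case by (simp add: homog_content_def)
next
  case (Suc m)
  then show ?case using homog_content_comm1[OF Suc, of "Suc (Suc m)"] by simp
qed

text \<open>Each bracket flips the sign under reversal. The induction starts at [2, 1], because a
  single letter has a nonzero derivative.\<close>

lemma nested_comm_signed_filt:
  "(nested_comm (Suc m) :: nat list \<Rightarrow> 'k::field) \<in> signed_filt ((-1) ^ Suc m) 0"
proof (induction m)
  case 0
  have D: "word_deriv x (nested_comm 0 :: nat list \<Rightarrow> 'k) = (\<lambda>u. if u = [] then (if x = 1 then 1 else 0) else 0)" for x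
  proof
    fix u
    show "word_deriv x (nested_comm 0 :: nat list \<Rightarrow> 'k) u = (if u = [] then (if x = 1 then 1 else 0) else 0)"
    proof (cases "u = []")
      case False
      have "(nested_comm 0 :: nat list \<Rightarrow> 'k) \<in> homog (Suc 0)" by (simp add: homog_def)
      from homogD[OF homog_word_deriv[OF this], of u x] show ?thesis using False by simp
    qed simp
  qed
  \<comment> \<open>Constants commute with letters, so bracketing a derivative of the letter 1 with
    \<open>y\<close> gives 0.\<close>
  have eq: "lconc y (\<lambda>u. if u = [] then c else 0) u = rconc y (\<lambda>u. if u = [] then c else 0) u"
    for y :: nat and c :: 'k and u
  proof -
    have "lconc y (\<lambda>u. if u = [] then c else 0) u = (if u = [y] then c else 0)" by (cases u) auto
    moreover have "rconc y (\<lambda>u. if u = [] then c else 0) u = (if u = [y] then c else 0)"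
      by (cases u rule: rev_cases) auto
    ultimately show ?thesis by simp
  qed
  have r: "nested_comm 0 (rev u) = (nested_comm 0 u :: 'k)" for u by (cases u) auto
  have "word_deriv x (comm1 2 (nested_comm 0)) u = (0 :: 'k)" for x u
    unfolding comm1_def[abs_def] word_deriv_diff word_deriv_lconc word_deriv_rconc D
    by (simp add: eq del: if_split)
  moreover have "comm1 2 (nested_comm 0) (rev u) = (- comm1 2 (nested_comm 0) u :: 'k)" for u
    unfolding comm1_def lconc_rev rconc_rev r by simp
  ultimately show ?case
    unfolding nested_comm.simps(2) by (simp add: fun_eq_iff numeral_2_eq_2 del: nested_comm.simps)
next
  case (Suc m)
  have "(comm1 (Suc (Suc (Suc m))) (nested_comm (Suc m)) :: nat list \<Rightarrow> 'k) \<in> signed_filt (- ((-1) ^ Suc m)) 0"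
    by (rule comm1_signed_filt[OF Suc])
  then show ?case
    unfolding nested_comm.simps(2)[of "Suc m"] power_Suc[of _ "Suc m"] by (simp only: mult_minus1)
qed

text \<open>The descending word ends in 1, so in each bracket only the term with the new letter in
  front contributes.\<close>

lemma nested_comm_value: "nested_comm m (descending (Suc m)) = 1"
proof (induction m)
  case (Suc m)
  have "rconc (Suc (Suc m)) (nested_comm m) (descending (Suc (Suc m))) = 0"
    by (rule rconc_last) (simp only: last_descending)
  then show ?case using Suc by (simp add: comm1_def)
qed simp

text \<open>The word starts with \<open>a\<close>, \<open>b\<close> and ends in 1, so only a b F
  among the four terms contributes.\<close>

lemma acomm2_nested_comm_value:
  fixes m :: nat
  defines "a \<equiv> Suc (Suc (Suc (Suc m)))" and "b \<equiv> Suc (Suc (Suc m))"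
  shows "acomm2 a b (nested_comm (Suc m) :: nat list \<Rightarrow> 'k::field) (descending a) = 1"
proof -
  have eq: "descending a = a # b # descending (Suc (Suc m))" by (simp add: a_def b_def)
  have R: "rconc y G (descending a) = 0" if "y > 1" for y and G :: "nat list \<Rightarrow> 'k"
    by (rule rconc_last) (use that last_descending[of b] in \<open>simp add: a_def b_def\<close>)
  have "rconc a G (descending a) = 0" "rconc b G (descending a) = 0" for G :: "nat list \<Rightarrow> 'k"
    by (rule R; simp add: a_def b_def)+
  moreover have "lconc a (lconc b (nested_comm (Suc m) :: nat list \<Rightarrow> 'k)) (descending a) = 1"
    unfolding eq lconc.simps nested_comm_value by simp
  moreover have "lconc b G (descending a) = 0" for G :: "nat list \<Rightarrow> 'k"
    unfolding eq lconc.simps by (simp add: a_def b_def)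
  ultimately show ?thesis unfolding acomm2_def by (simp only: diff_zero add_0_right)
qed

lemma notin_deriv_filt_0: "F u = 1 \<Longrightarrow> F \<notin> deriv_filt 0"
  by auto

text \<open>The empty word serves m = 0, and for m \<ge> 2 the nested commutator has sign
  \<open>(-1) ^ (m - 1)\<close>. For m \<ge> 4 the anticommutator of [m, m - 1] with the nested
  commutator on m - 2 letters has the other sign.\<close>

lemma nonzero_kernel_element_exists:
  fixes e :: "'k::field"
  assumes "m = 0 \<and> e = 1 \<or> m = 2 \<and> e = -1 \<or> m = 3 \<and> e = 1 \<or> m \<ge> 4 \<and> (e = 1 \<or> e = -1)"
  shows "\<exists>Q \<in> signed_filt e 0. Q \<notin> deriv_filt 0 \<and> Q \<in> homog_content (mset (descending m))"
    (is "?P m e")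
proof -
  have nested: "?P (Suc (Suc j)) ((-1) ^ Suc j)" for j
    by (intro bexI[of _ "nested_comm (Suc j)"] conjI notin_deriv_filt_0[where u = "descending (Suc (Suc j))"] nested_comm_value
        nested_comm_homog_content nested_comm_signed_filt)
  have anti: "?P (Suc (Suc (Suc (Suc j)))) (- ((-1) ^ Suc j))" for j
  proof (intro bexI conjI)
    let ?Q = "acomm2 (Suc (Suc (Suc (Suc j)))) (Suc (Suc (Suc j))) (nested_comm (Suc j)) :: nat list \<Rightarrow> 'k"
    show "?Q \<notin> deriv_filt 0"
      by (rule notin_deriv_filt_0) (rule acomm2_nested_comm_value)
    show "?Q \<in> signed_filt (- ((-1) ^ Suc j)) 0"
      by (intro acomm2_signed_filt nested_comm_signed_filt)
    show "?Q \<in> homog_content (mset (descending (Suc (Suc (Suc (Suc j))))))"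
      using homog_content_acomm2[OF nested_comm_homog_content[of "Suc j"]] by simp
  qed
  have unit: "?P 0 1"
  proof (intro bexI conjI)
    let ?Q = "(\<lambda>u. if u = [] then 1 else 0) :: nat list \<Rightarrow> 'k"
    show "?Q \<notin> deriv_filt 0" by (rule notin_deriv_filt_0[of _ "[]"]) simp
    show "?Q \<in> signed_filt 1 0" by (simp add: word_deriv_eq_sum fun_eq_iff)
    show "?Q \<in> homog_content (mset (descending 0))" by (simp add: homog_content_def)
  qed
  consider "m = 0" "e = 1" | "m = 2" "e = -1" | "m = 3" "e = 1"
    | "m \<ge> 4" "e = 1 \<or> e = -1"
    using assms by blast
  then show ?thesis
  proof cases
    case 1
    then show ?thesis using unit by (simp only:)
  next
    case 2
    then show ?thesis using nested[of 0] by (simp only: numeral_2_eq_2 power_Suc power_0 mult_1_right)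
  next
    case 3
    then show ?thesis
      using nested[of 1] by (simp only: numeral_3_eq_3 One_nat_def power_Suc power_0 mult_1_right minus_mult_minus)
  next
    case 4
    define j where "j = m - 4"
    have m: "m = Suc (Suc (Suc (Suc j)))" using 4 by (simp add: j_def)
    \<comment> \<open>The exponents have equal parity, so the two values are 1 and -1 in some
      order.\<close>
    have "e = (-1) ^ Suc (Suc (Suc j)) \<or> e = - ((-1) ^ Suc j)"
      using 4(2) by (cases "even j") auto
    then show ?thesis
      unfolding m using nested[of "Suc (Suc j)"] anti[of j] by (elim disjE) (simp_all only:)
  qed
qed

text \<open>The fresh letters m + 1, ..., m + j are multiplied on from the left one at a time, each
  raising the layer by one.\<close>

lemma lconc_extension_exists:
  assumes "Q \<in> signed_filt e 0" "Q \<notin> deriv_filt 0" "Q \<in> homog_content (mset (descending m))"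
  shows "\<exists>F \<in> signed_filt e j. F \<notin> deriv_filt j \<and> F \<in> homog_content (mset (descending (m + j)))"
proof (induction j)
  case 0
  then show ?case using assms by auto
next
  case (Suc j)
  then obtain F where F: "F \<in> signed_filt e j" "F \<notin> deriv_filt j" "F \<in> homog_content (mset (descending (m + j)))"
    by blast
  let ?y = "Suc (m + j)"
  show ?case
  proof (intro bexI conjI)
    show "lconc ?y F \<in> signed_filt e (Suc j)" by (rule lconc_signed_filt[OF F(1)])
    show "lconc ?y F \<notin> deriv_filt (Suc j)" by (rule lconc_notin_deriv_filt[OF F(3) _ F(2)]) (simp add: set_descending)
    show "lconc ?y F \<in> homog_content (mset (descending (m + Suc j)))"
      using homog_content_lconc[OF F(3), of ?y] by simp
  qed
qed

lemma eigenvector_mod_filt_exists: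
  assumes "n > 1" "k \<in> L n"
  shows "\<exists>e j. \<exists>F \<in> signed_filt e j. F \<notin> deriv_filt j \<and> F \<in> homog_content (mset (descending n))
           \<and> (e :: 'k::field) * of_nat j = of_int k"
proof -
  obtain j where j: "j \<le> n" "k \<in> layer_spec n j" using assms(2) unfolding L_eq_layers[OF assms(1)] by blast
  define m where "m = n - j"
  \<comment> \<open>\<open>m\<close> is the degree of the kernel element: for m = 0, 2, 3 it forces
    the sign, otherwise the sign of \<open>k\<close> is taken. The case m = 1 cannot occur, its
    layer being empty.\<close>
  define e :: 'k where "e = (if m = 0 \<or> m = 3 then 1 else if m = 2 then -1 else if k = int j then 1 else -1)"
  have "m = 0 \<and> e = 1 \<or> m = 2 \<and> e = -1 \<or> m = 3 \<and> e = 1 \<or> m \<ge> 4 \<and> (e = 1 \<or> e = -1)"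
    using j unfolding e_def m_def layer_spec_def by (auto split: if_splits)
  from nonzero_kernel_element_exists[OF this]
  obtain Q where "Q \<in> signed_filt e 0" "Q \<notin> deriv_filt 0" "Q \<in> homog_content (mset (descending m))" by blast
  from lconc_extension_exists[OF this, of j]
  have "\<exists>F \<in> signed_filt e j. F \<notin> deriv_filt j \<and> F \<in> homog_content (mset (descending n))"
    using j by (simp add: m_def)
  moreover have "e * of_nat j = of_int k"
    using j unfolding e_def m_def layer_spec_def by (auto split: if_splits)
  ultimately show ?thesis by blast
qed

section \<open>The group algebra\<close>

lemma group_algebra_simps [simp]:
  "carrier (group_algebra G) = {f. \<forall>g. g \<notin> carrier G \<longrightarrow> f g = 0}"
  "\<one>\<^bsub>group_algebra G\<^esub> = basis_elem \<one>\<^bsub>G\<^esub>"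
  "\<zero>\<^bsub>group_algebra G\<^esub> = (\<lambda>g. 0)"
  "f \<oplus>\<^bsub>group_algebra G\<^esub> h = (\<lambda>g. f g + h g)"
  "c \<odot>\<^bsub>group_algebra G\<^esub> f = (\<lambda>g. c * f g)"
  by (simp_all add: group_algebra_def basis_elem_def fun_eq_iff)

lemma group_algebra_mult_outside:
  assumes "monoid G" "g \<notin> carrier G"
  shows "(f \<otimes>\<^bsub>group_algebra G\<^esub> h) g = 0"
proof -
  have "{(x, y) \<in> carrier G \<times> carrier G. x \<otimes>\<^bsub>G\<^esub> y = g} = {}"
    using assms monoid.m_closed by fastforce
  then show ?thesis by (simp only: group_algebra_def monoid.simps partial_object.simps sum.empty)
qed

text \<open>In a group the second factor of a product equal to \<open>g\<close> is determined by the
  first.\<close>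

lemma group_algebra_mult_apply:
  assumes "group G" "g \<in> carrier G"
  shows "(f \<otimes>\<^bsub>group_algebra G\<^esub> h) g = (\<Sum>x\<in>carrier G. f x * h (inv\<^bsub>G\<^esub> x \<otimes>\<^bsub>G\<^esub> g))"
proof -
  interpret group G by fact
  have "{(x, y) \<in> carrier G \<times> carrier G. x \<otimes>\<^bsub>G\<^esub> y = g} = (\<lambda>x. (x, inv\<^bsub>G\<^esub> x \<otimes>\<^bsub>G\<^esub> g)) ` carrier G"
    using assms(2) by (auto simp: inv_solve_left image_iff m_assoc[symmetric])
  moreover have "inj_on (\<lambda>x. (x, inv\<^bsub>G\<^esub> x \<otimes>\<^bsub>G\<^esub> g)) (carrier G)" by (simp add: inj_on_def)
  ultimately show ?thesis by (simp add: group_algebra_def sum.reindex)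
qed

lemma group_algebra_closed:
  assumes "monoid G"
  shows "f \<otimes>\<^bsub>group_algebra G\<^esub> h \<in> carrier (group_algebra G)"
  by (simp add: group_algebra_mult_outside[OF assms])

lemma basis_elem_mult:
  assumes "group G" "finite (carrier G)" "a \<in> carrier G" "g \<in> carrier G"
  shows "(basis_elem a \<otimes>\<^bsub>group_algebra G\<^esub> f) g = f (inv\<^bsub>G\<^esub> a \<otimes>\<^bsub>G\<^esub> g)"
proof -
  have "(\<Sum>x\<in>carrier G. basis_elem a x * f (inv\<^bsub>G\<^esub> x \<otimes>\<^bsub>G\<^esub> g))
      = (\<Sum>x\<in>carrier G. if x = a then f (inv\<^bsub>G\<^esub> x \<otimes>\<^bsub>G\<^esub> g) else 0)"
    by (rule sum.cong) (auto simp: basis_elem_def)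
  then show ?thesis using assms by (simp add: group_algebra_mult_apply)
qed

lemma mult_basis_elem:
  assumes "group G" "finite (carrier G)" "a \<in> carrier G" "g \<in> carrier G"
  shows "(f \<otimes>\<^bsub>group_algebra G\<^esub> basis_elem a) g = f (g \<otimes>\<^bsub>G\<^esub> inv\<^bsub>G\<^esub> a)"
proof -
  interpret group G by fact
  have "(\<Sum>x\<in>carrier G. f x * basis_elem a (inv\<^bsub>G\<^esub> x \<otimes>\<^bsub>G\<^esub> g))
      = (\<Sum>x\<in>carrier G. if x = g \<otimes>\<^bsub>G\<^esub> inv\<^bsub>G\<^esub> a then f x else 0)"
  proof (rule sum.cong)
    fix x assume x: "x \<in> carrier G"
    have "inv\<^bsub>G\<^esub> x \<otimes>\<^bsub>G\<^esub> g = a \<longleftrightarrow> x = g \<otimes>\<^bsub>G\<^esub> inv\<^bsub>G\<^esub> a"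
      using x assms(3,4) by (metis inv_solve_left inv_solve_right inv_closed m_closed)
    then show "f x * basis_elem a (inv\<^bsub>G\<^esub> x \<otimes>\<^bsub>G\<^esub> g) = (if x = g \<otimes>\<^bsub>G\<^esub> inv\<^bsub>G\<^esub> a then f x else 0)"
      by (simp add: basis_elem_def)
  qed simp
  then show ?thesis using assms by (simp add: group_algebra_mult_apply)
qed

lemma group_algebra_assoc:
  assumes "group G" "finite (carrier G)"
  shows "(f \<otimes>\<^bsub>group_algebra G\<^esub> h) \<otimes>\<^bsub>group_algebra G\<^esub> k
    = f \<otimes>\<^bsub>group_algebra G\<^esub> (h \<otimes>\<^bsub>group_algebra G\<^esub> k)"
proof
  fix g
  interpret group G by fact
  show "((f \<otimes>\<^bsub>group_algebra G\<^esub> h) \<otimes>\<^bsub>group_algebra G\<^esub> k) g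
    = (f \<otimes>\<^bsub>group_algebra G\<^esub> (h \<otimes>\<^bsub>group_algebra G\<^esub> k)) g"
  proof (cases "g \<in> carrier G")
    case False
    then show ?thesis by (simp add: group_algebra_mult_outside is_monoid)
  next
    case g: True
    have inner: "(\<Sum>x\<in>carrier G. h (inv\<^bsub>G\<^esub> y \<otimes>\<^bsub>G\<^esub> x) * k (inv\<^bsub>G\<^esub> x \<otimes>\<^bsub>G\<^esub> g))
        = (h \<otimes>\<^bsub>group_algebra G\<^esub> k) (inv\<^bsub>G\<^esub> y \<otimes>\<^bsub>G\<^esub> g)" if y: "y \<in> carrier G" for y
    proof -
      have "(\<Sum>z\<in>carrier G. h z * k (inv\<^bsub>G\<^esub> z \<otimes>\<^bsub>G\<^esub> (inv\<^bsub>G\<^esub> y \<otimes>\<^bsub>G\<^esub> g)))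
          = (\<Sum>x\<in>carrier G. h (inv\<^bsub>G\<^esub> y \<otimes>\<^bsub>G\<^esub> x) * k (inv\<^bsub>G\<^esub> x \<otimes>\<^bsub>G\<^esub> g))"
        \<comment> \<open>Substitution x = y z.\<close>
        by (rule sum.reindex_bij_witness[where i = "\<lambda>x. inv\<^bsub>G\<^esub> y \<otimes>\<^bsub>G\<^esub> x" and j = "\<lambda>z. y \<otimes>\<^bsub>G\<^esub> z"])
          (use y g in \<open>simp_all add: m_assoc[symmetric] inv_mult_group\<close>)
      then show ?thesis using y g by (simp add: group_algebra_mult_apply assms)
    qed
    have "((f \<otimes>\<^bsub>group_algebra G\<^esub> h) \<otimes>\<^bsub>group_algebra G\<^esub> k) g
        = (\<Sum>x\<in>carrier G. \<Sum>y\<in>carrier G. f y * (h (inv\<^bsub>G\<^esub> y \<otimes>\<^bsub>G\<^esub> x) * k (inv\<^bsub>G\<^esub> x \<otimes>\<^bsub>G\<^esub> g)))"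
      using g by (simp add: group_algebra_mult_apply assms sum_distrib_right mult.assoc)
    also have "\<dots> = (\<Sum>y\<in>carrier G. f y * (\<Sum>x\<in>carrier G. h (inv\<^bsub>G\<^esub> y \<otimes>\<^bsub>G\<^esub> x) * k (inv\<^bsub>G\<^esub> x \<otimes>\<^bsub>G\<^esub> g)))"
      by (subst sum.swap) (simp add: sum_distrib_left)
    also have "\<dots> = (f \<otimes>\<^bsub>group_algebra G\<^esub> (h \<otimes>\<^bsub>group_algebra G\<^esub> k)) g"
      using g by (simp add: group_algebra_mult_apply[OF assms(1), of g f] inner)
    finally show ?thesis .
  qed
qed

lemma group_algebra_monoid:
  assumes "group G" "finite (carrier G)"
  shows "monoid (group_algebra G :: ('k::field, _) module)"
proof -
  interpret group G by fact
  have one: "(basis_elem \<one>\<^bsub>G\<^esub> \<otimes>\<^bsub>group_algebra G\<^esub> f) = f" "(f \<otimes>\<^bsub>group_algebra G\<^esub> basis_elem \<one>\<^bsub>G\<^esub>) = f"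
    if "\<forall>g. g \<notin> carrier G \<longrightarrow> f g = 0" for f :: "_ \<Rightarrow> 'k"
  proof -
    show "(basis_elem \<one>\<^bsub>G\<^esub> \<otimes>\<^bsub>group_algebra G\<^esub> f) = f"
    proof
      fix g
      show "(basis_elem \<one>\<^bsub>G\<^esub> \<otimes>\<^bsub>group_algebra G\<^esub> f) g = f g"
        using that by (cases "g \<in> carrier G")
          (simp_all add: basis_elem_mult assms group_algebra_mult_outside is_monoid)
    qed
    show "(f \<otimes>\<^bsub>group_algebra G\<^esub> basis_elem \<one>\<^bsub>G\<^esub>) = f"
    proof
      fix g
      show "(f \<otimes>\<^bsub>group_algebra G\<^esub> basis_elem \<one>\<^bsub>G\<^esub>) g = f g"
        using that by (cases "g \<in> carrier G")
          (simp_all add: mult_basis_elem assms group_algebra_mult_outside is_monoid)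
    qed
  qed
  show ?thesis
  proof (rule monoidI)
    fix f h :: "_ \<Rightarrow> 'k"
    show "f \<otimes>\<^bsub>group_algebra G\<^esub> h \<in> carrier (group_algebra G)"
      by (rule group_algebra_closed[OF is_monoid])
  qed (use one group_algebra_assoc[OF assms] in \<open>auto simp: basis_elem_def\<close>)
qed

lemma group_algebra_abelian_monoid: "abelian_monoid (group_algebra G)"
  by (rule abelian_monoidI) (auto simp: add_ac)

lemma group_algebra_finsum_apply:
  fixes f :: "'i \<Rightarrow> 'g \<Rightarrow> 'k::field"
  assumes "finite I" "\<And>i. i \<in> I \<Longrightarrow> f i \<in> carrier (group_algebra G)"
  shows "(\<Oplus>\<^bsub>group_algebra G\<^esub>i\<in>I. f i) g = (\<Sum>i\<in>I. f i g)"
  using assms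
proof (induction I rule: finite_induct)
  case empty
  interpret abelian_monoid "group_algebra G :: ('k, 'g \<Rightarrow> 'k) module" by (rule group_algebra_abelian_monoid)
  show ?case by simp
next
  case (insert i I)
  interpret abelian_monoid "group_algebra G :: ('k, 'g \<Rightarrow> 'k) module" by (rule group_algebra_abelian_monoid)
  have "(\<Oplus>\<^bsub>group_algebra G\<^esub>j\<in>insert i I. f j) = f i \<oplus>\<^bsub>group_algebra G\<^esub> (\<Oplus>\<^bsub>group_algebra G\<^esub>j\<in>I. f j)"
    by (rule finsum_insert) (use insert in \<open>auto\<close>)
  then show ?case using insert by simp
qed

section \<open>Polynomials evaluated in the group algebra\<close>

lemma alg_eval_apply:
  fixes p :: "'k::field poly"
  assumes "group G" "finite (carrier G)" "a \<in> carrier (group_algebra G)"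
  shows "alg_eval (group_algebra G) p a g = (\<Sum>i\<le>degree p. coeff p i * (a [^]\<^bsub>group_algebra G\<^esub> i) g)"
proof -
  interpret monoid "group_algebra G :: ('k, _) module" by (rule group_algebra_monoid[OF assms(1,2)])
  have "a [^]\<^bsub>group_algebra G\<^esub> i \<in> carrier (group_algebra G)" for i :: nat
    using assms(3) by (rule nat_pow_closed)
  then show ?thesis
    unfolding alg_eval_def by (subst group_algebra_finsum_apply) auto
qed

lemma alg_eval_closed:
  fixes p :: "'k::field poly"
  assumes "group G" "finite (carrier G)" "a \<in> carrier (group_algebra G)"
  shows "alg_eval (group_algebra G) p a \<in> carrier (group_algebra G)"
proof -
  interpret monoid "group_algebra G :: ('k, _) module" by (rule group_algebra_monoid[OF assms(1,2)])
  have "(a [^]\<^bsub>group_algebra G\<^esub> i) g = 0" if "g \<notin> carrier G" for i :: nat and g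
    using nat_pow_closed[OF assms(3), of i] that by simp
  then show ?thesis by (simp add: alg_eval_apply[OF assms] del: group_algebra_simps(2-))
qed

lemma alg_eval_mult_apply:
  fixes p :: "'k::field poly"
  assumes "group G" "finite (carrier G)" "a \<in> carrier (group_algebra G)" "g \<in> carrier G"
  shows "(alg_eval (group_algebra G) p a \<otimes>\<^bsub>group_algebra G\<^esub> h) g
    = (\<Sum>i\<le>degree p. coeff p i * ((a [^]\<^bsub>group_algebra G\<^esub> i) \<otimes>\<^bsub>group_algebra G\<^esub> h) g)"
  by (simp add: group_algebra_mult_apply assms alg_eval_apply[OF assms(1-3)] sum_distrib_right
      sum_distrib_left mult.assoc del: group_algebra_simps(1)) (rule sum.swap)

lemma basis_elem_involution:
  fixes G :: "('g, 'm) monoid_scheme"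
  defines "M \<equiv> group_algebra G :: ('k::field, 'g \<Rightarrow> 'k) module"
  assumes G: "group G" "finite (carrier G)" and w: "w \<in> carrier G" "w \<otimes>\<^bsub>G\<^esub> w = \<one>\<^bsub>G\<^esub>"
  shows "basis_elem w \<otimes>\<^bsub>M\<^esub> basis_elem w = \<one>\<^bsub>M\<^esub>"
proof
  fix g
  interpret group G by fact
  have iw: "inv\<^bsub>G\<^esub> w = w" using w by (simp add: inv_equality)
  show "(basis_elem w \<otimes>\<^bsub>M\<^esub> basis_elem w) g = \<one>\<^bsub>M\<^esub> g"
  proof (cases "g \<in> carrier G")
    case True
    have "w \<otimes>\<^bsub>G\<^esub> g = w \<longleftrightarrow> g = \<one>\<^bsub>G\<^esub>" using True w(1) by (metis l_cancel_one)
    then show ?thesis using True w unfolding M_def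
      by (simp add: basis_elem_mult G iw) (simp add: basis_elem_def)
  next
    case False
    then have "g \<noteq> \<one>\<^bsub>G\<^esub>" by auto
    then show ?thesis using False unfolding M_def
      by (simp add: group_algebra_mult_outside is_monoid) (simp add: basis_elem_def)
  qed
qed

text \<open>Conjugation by an involution respects powers and linear combinations; on coefficients it
  replaces \<open>g\<close> by w g w.\<close>

lemma alg_eval_conj:
  fixes p :: "'k::field poly" and G :: "('g, 'm) monoid_scheme"
  defines "M \<equiv> group_algebra G :: ('k, 'g \<Rightarrow> 'k) module"
  assumes G: "group G" "finite (carrier G)" and w: "w \<in> carrier G" "w \<otimes>\<^bsub>G\<^esub> w = \<one>\<^bsub>G\<^esub>"
    and X: "X \<in> carrier M" and zero: "alg_eval M p X = \<zero>\<^bsub>M\<^esub>"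
  shows "alg_eval M p (basis_elem w \<otimes>\<^bsub>M\<^esub> X \<otimes>\<^bsub>M\<^esub> basis_elem w) = \<zero>\<^bsub>M\<^esub>"
proof -
  interpret group G by fact
  interpret M: monoid M unfolding M_def by (rule group_algebra_monoid[OF G])
  define W where "W = (basis_elem w :: 'g \<Rightarrow> 'k)"
  have iw: "inv\<^bsub>G\<^esub> w = w" using w by (simp add: inv_equality)
  have W: "W \<in> carrier M" using w by (auto simp: M_def W_def basis_elem_def)
  have WW: "W \<otimes>\<^bsub>M\<^esub> W = \<one>\<^bsub>M\<^esub>" unfolding W_def M_def by (rule basis_elem_involution[OF G w])
  then have WWl: "W \<otimes>\<^bsub>M\<^esub> (W \<otimes>\<^bsub>M\<^esub> Y) = Y" if "Y \<in> carrier M" for Y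
    using that W by (simp add: M.m_assoc[symmetric])
  let ?Y = "W \<otimes>\<^bsub>M\<^esub> X \<otimes>\<^bsub>M\<^esub> W"
  have Y: "?Y \<in> carrier M" using W X by simp
  have pow: "?Y [^]\<^bsub>M\<^esub> i = W \<otimes>\<^bsub>M\<^esub> (X [^]\<^bsub>M\<^esub> i) \<otimes>\<^bsub>M\<^esub> W" for i :: nat
  proof (induction i)
    case 0
    then show ?case using W WW by simp
  next
    case (Suc i)
    have "?Y [^]\<^bsub>M\<^esub> Suc i = W \<otimes>\<^bsub>M\<^esub> (X [^]\<^bsub>M\<^esub> i) \<otimes>\<^bsub>M\<^esub> W \<otimes>\<^bsub>M\<^esub> ?Y" using Suc by simp
    also have "\<dots> = W \<otimes>\<^bsub>M\<^esub> (X [^]\<^bsub>M\<^esub> i \<otimes>\<^bsub>M\<^esub> X) \<otimes>\<^bsub>M\<^esub> W"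
      using X W by (simp add: M.m_assoc WWl)
    finally show ?case by simp
  qed
  have conj: "(W \<otimes>\<^bsub>M\<^esub> Z \<otimes>\<^bsub>M\<^esub> W) g = Z (w \<otimes>\<^bsub>G\<^esub> (g \<otimes>\<^bsub>G\<^esub> w))" if "g \<in> carrier G" for Z g
    using that w unfolding W_def M_def by (simp add: mult_basis_elem basis_elem_mult G iw)
  have "alg_eval M p ?Y g = \<zero>\<^bsub>M\<^esub> g" for g
  proof (cases "g \<in> carrier G")
    case True
    have "alg_eval M p ?Y g = alg_eval M p X (w \<otimes>\<^bsub>G\<^esub> (g \<otimes>\<^bsub>G\<^esub> w))"
      using alg_eval_apply[OF G X[unfolded M_def]] alg_eval_apply[OF G Y[unfolded M_def]]
      by (simp add: M_def[symmetric] pow conj[OF True])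
    then show ?thesis unfolding zero by (simp add: M_def)
  next
    case False
    then show ?thesis
      using alg_eval_closed[OF G Y[unfolded M_def], of p] by (simp add: M_def)
  qed
  then show ?thesis unfolding W_def by blast
qed

section \<open>Transfer to the group algebra\<close>

lemma finite_sym_group: "finite (carrier (sym_group n))"
  by (simp add: sym_group_def finite_permutations)

lemma w0_permutes: "w0 n permutes {1..n}"
  by (rule bij_imp_permutes) (auto simp: w0_def intro!: bij_betw_byWitness[where f' = "w0 n"])

lemma w0_w0: "w0 n \<circ> w0 n = id"
  by (auto simp: w0_def fun_eq_iff)

lemma cycle_permutes_interval: "i \<le> n \<Longrightarrow> cycle_of_list [1..<Suc i] permutes {1..n}"
  using cycle_permutes[of "[1..<Suc i]"] by (rule permutes_subset) auto

lemma top_to_random_apply: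
  "top_to_random n g = (\<Sum>i\<in>{1..n}. basis_elem (cycle_of_list [1..<Suc i]) g)"
  unfolding top_to_random_def
  by (rule group_algebra_finsum_apply)
    (auto simp: basis_elem_def sym_group_carrier cycle_permutes_interval simp del: upt_Suc One_nat_def)

lemma top_to_random_closed: "top_to_random n \<in> carrier (group_algebra (sym_group n))"
  by (auto simp: top_to_random_apply basis_elem_def sym_group_carrier cycle_permutes_interval
      intro!: sum.neutral simp del: upt_Suc One_nat_def)

lemma top_to_random_mult:
  assumes "g permutes {1..n}"
  shows "(top_to_random n \<otimes>\<^bsub>group_algebra (sym_group n)\<^esub> h) g
    = (\<Sum>i\<in>{1..n}. h (inv' (cycle_of_list [1..<Suc i]) \<circ> g))"
proof -
  let ?M = "group_algebra (sym_group n)"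
  have g: "g \<in> carrier (sym_group n)" using assms by (simp add: sym_group_carrier)
  have "(top_to_random n \<otimes>\<^bsub>?M\<^esub> h) g
      = (\<Sum>i\<in>{1..n}. (basis_elem (cycle_of_list [1..<Suc i]) \<otimes>\<^bsub>?M\<^esub> h) g)"
    by (simp add: group_algebra_mult_apply[OF sym_group_is_group g] top_to_random_apply
        sum_distrib_right del: upt_Suc) (rule sum.swap)
  also have "\<dots> = (\<Sum>i\<in>{1..n}. h (inv' (cycle_of_list [1..<Suc i]) \<circ> g))"
  proof (rule sum.cong)
    fix i assume "i \<in> {1..n}"
    then have c: "cycle_of_list [1..<Suc i] \<in> carrier (sym_group n)"
      by (simp add: sym_group_carrier cycle_permutes_interval del: upt_Suc One_nat_def)
    show "(basis_elem (cycle_of_list [1..<Suc i]) \<otimes>\<^bsub>?M\<^esub> h) g = h (inv' (cycle_of_list [1..<Suc i]) \<circ> g)"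
      using basis_elem_mult[OF sym_group_is_group finite_sym_group c g, of h] sym_group_inv_equality[OF c]
      by (simp only: sym_group_mult)
  qed simp
  finally show ?thesis .
qed

text \<open>A permutation \<open>\<sigma>\<close> is read as the word of values of its inverse, because it is then that left
  multiplication acts on positions.\<close>

definition pull :: "nat \<Rightarrow> (nat list \<Rightarrow> 'k::field) \<Rightarrow> (nat \<Rightarrow> nat) \<Rightarrow> 'k" where
  "pull n F \<sigma> = (if \<sigma> permutes {1..n} then F (map (inv' \<sigma>) [1..<Suc n]) else 0)"

lemma map_w0: "map (w0 n) [1..<Suc n] = rev [1..<Suc n]"
  by (rule nth_equalityI) (auto simp: w0_def rev_nth simp del: upt_Suc)

lemma map_cycle:
  assumes "1 \<le> i" "i \<le> n"
  shows "map (cycle_of_list [1..<Suc i]) [1..<Suc n] = [2..<Suc i] @ 1 # [Suc i..<Suc n]"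
proof -
  have "[1..<Suc n] = [1..<Suc i] @ [Suc i..<Suc n]"
    using assms upt_add_eq_append[of 1 "Suc i" "n - i"] by simp
  moreover have "map (cycle_of_list [1..<Suc i]) [1..<Suc i] = [2..<Suc i] @ [1]"
    using cyclic_rotation[of "[1..<Suc i]" 1] assms
    by (simp add: upt_conv_Cons numeral_2_eq_2 del: upt_Suc)
  moreover have "map (cycle_of_list [1..<Suc i]) [Suc i..<Suc n] = [Suc i..<Suc n]"
    by (rule map_idI) (auto intro: id_outside_supp simp del: upt_Suc)
  ultimately show ?thesis by (simp del: upt_Suc)
qed

text \<open>Precomposing with \<open>w0 n\<close> reverses the word, and the cycle then moves its
  first letter to place \<open>i\<close>. These are the insertions summed by T.\<close>

lemma rev_shuffle_word:
  assumes "n > 0"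
  shows "rev_shuffle F (map v [1..<Suc n])
    = (\<Sum>i\<in>{1..n}. F (map (v \<circ> w0 n \<circ> cycle_of_list [1..<Suc i]) [1..<Suc n]))"
proof -
  define v' where "v' = v \<circ> w0 n"
  have eq: "rev (map v [1..<Suc n]) = map v' [1..<Suc n]"
    unfolding v'_def by (simp only: map_map[symmetric] map_w0 rev_map)
  also have "\<dots> = v' 1 # map v' [2..<Suc n]"
    using assms by (simp add: upt_conv_Cons numeral_2_eq_2 del: upt_Suc)
  finally have "map v [1..<Suc n] = rev (v' 1 # map v' [2..<Suc n])"
    by (metis rev_rev_ident)
  then have "rev_shuffle F (map v [1..<Suc n]) = word_deriv (v' 1) F (map v' [2..<Suc n])"
    by (simp del: upt_Suc)
  also have "\<dots> = (\<Sum>k\<le>n - 1. F (map v' (take k [2..<Suc n]) @ v' 1 # map v' (drop k [2..<Suc n])))"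
    by (simp add: word_deriv_eq_sum take_map drop_map del: upt_Suc)
  also have "\<dots> = (\<Sum>i\<in>{1..n}. F (map (v' \<circ> cycle_of_list [1..<Suc i]) [1..<Suc n]))"
  \<comment> \<open>A letter inserted at place i has i - 1 letters before it.\<close>
  proof (rule sum.reindex_bij_witness[where i = "\<lambda>i. i - 1" and j = Suc])
    fix k assume "k \<in> {..n - 1}"
    then have k: "1 \<le> Suc k" "Suc k \<le> n" using assms by auto
    then have "take k [2..<Suc n] = [2..<Suc (Suc k)]" "drop k [2..<Suc n] = [Suc (Suc k)..<Suc n]"
      by (simp_all add: take_upt del: upt_Suc)
    then show "F (map (v' \<circ> cycle_of_list [1..<Suc (Suc k)]) [1..<Suc n])
        = F (map v' (take k [2..<Suc n]) @ v' 1 # map v' (drop k [2..<Suc n]))"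
      by (simp only: map_map[symmetric] map_cycle[OF k] map_append list.map)
  qed (use assms in auto)
  finally show ?thesis by (simp only: v'_def)
qed

text \<open>The coefficient at \<open>g\<close> sums those at
  \<open>c\<^sub>i\<inverse> w\<^sub>0 g\<close>, where \<open>c\<^sub>i\<close> is the cycle of
  length i. The inverse \<open>g\<inverse> w\<^sub>0 c\<^sub>i\<close> rearranges the positions in
  the word of \<open>g\<inverse>\<close>.\<close>

lemma shuffle_mult_pull:
  fixes F :: "nat list \<Rightarrow> 'k::field" and n :: nat
  assumes "n > 0"
  defines "M \<equiv> group_algebra (sym_group n) :: ('k, (nat \<Rightarrow> nat) \<Rightarrow> 'k) module"
  shows "(basis_elem (w0 n) \<otimes>\<^bsub>M\<^esub> top_to_random n) \<otimes>\<^bsub>M\<^esub> pull n F = pull n (rev_shuffle F)"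
proof
  fix g
  have M: "group (sym_group n)" "finite (carrier (sym_group n))"
    by (simp_all add: sym_group_is_group finite_sym_group)
  show "((basis_elem (w0 n) \<otimes>\<^bsub>M\<^esub> top_to_random n) \<otimes>\<^bsub>M\<^esub> pull n F) g = pull n (rev_shuffle F) g"
  proof (cases "g permutes {1..n}")
    case False
    then show ?thesis unfolding M_def
      by (simp add: pull_def group_algebra_mult_outside group.is_monoid[OF M(1)] sym_group_carrier)
  next
    case g: True
    have w: "w0 n \<in> carrier (sym_group n)" by (simp add: sym_group_carrier w0_permutes del: One_nat_def)
    have iw: "inv' (w0 n) = w0 n" by (rule inv_unique_comp) (rule w0_w0)+
    have wg: "w0 n \<circ> g permutes {1..n}" using g w0_permutes by (rule permutes_compose)
    have "((basis_elem (w0 n) \<otimes>\<^bsub>M\<^esub> top_to_random n) \<otimes>\<^bsub>M\<^esub> pull n F) g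
        = (top_to_random n \<otimes>\<^bsub>M\<^esub> pull n F) (w0 n \<circ> g)"
      unfolding M_def group_algebra_assoc[OF M]
      using basis_elem_mult[OF M w, of g] g
      by (simp add: sym_group_carrier sym_group_inv_equality[OF w] iw sym_group_mult)
    also have "\<dots> = (\<Sum>i\<in>{1..n}. pull n F (inv' (cycle_of_list [1..<Suc i]) \<circ> (w0 n \<circ> g)))"
      unfolding M_def by (rule top_to_random_mult[OF wg])
    also have "\<dots> = (\<Sum>i\<in>{1..n}. F (map (inv' g \<circ> w0 n \<circ> cycle_of_list [1..<Suc i]) [1..<Suc n]))"
    proof (rule sum.cong)
      fix i assume "i \<in> {1..n}"
      then have c: "cycle_of_list [1..<Suc i] permutes {1..n}"
        by (simp add: cycle_permutes_interval del: upt_Suc One_nat_def)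
      have p: "inv' (cycle_of_list [1..<Suc i]) \<circ> (w0 n \<circ> g) permutes {1..n}"
        by (rule permutes_compose[OF wg permutes_inv[OF c]])
      have "inv' (inv' (cycle_of_list [1..<Suc i]) \<circ> (w0 n \<circ> g)) = inv' g \<circ> w0 n \<circ> cycle_of_list [1..<Suc i]"
        using permutes_bij[OF c] permutes_bij[OF g] permutes_bij[OF w0_permutes[of n]]
        by (simp add: o_inv_distrib bij_comp bij_imp_bij_inv inv_inv_eq iw del: upt_Suc)
      then show "pull n F (inv' (cycle_of_list [1..<Suc i]) \<circ> (w0 n \<circ> g))
          = F (map (inv' g \<circ> w0 n \<circ> cycle_of_list [1..<Suc i]) [1..<Suc n])"
        unfolding pull_def using p by (simp only: if_True)
    qed simp
    also have "\<dots> = pull n (rev_shuffle F) g"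
      unfolding rev_shuffle_word[OF assms(1), symmetric] pull_def using g by simp
    finally show ?thesis .
  qed
qed

lemma pull_closed: "pull n F \<in> carrier (group_algebra (sym_group n))"
  by (simp add: pull_def sym_group_carrier)

lemma alg_eval_mult_pull:
  fixes F :: "nat list \<Rightarrow> 'k::field" and n :: nat
  defines "M \<equiv> group_algebra (sym_group n) :: ('k, (nat \<Rightarrow> nat) \<Rightarrow> 'k) module"
  assumes "n > 0"
  shows "alg_eval M p (basis_elem (w0 n) \<otimes>\<^bsub>M\<^esub> top_to_random n) \<otimes>\<^bsub>M\<^esub> pull n F
    = pull n (shuffle_eval p F)"
proof -
  have G: "group (sym_group n)" "finite (carrier (sym_group n))"
    by (simp_all add: sym_group_is_group finite_sym_group)
  interpret M: monoid M unfolding M_def by (rule group_algebra_monoid[OF G])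
  let ?a = "basis_elem (w0 n) \<otimes>\<^bsub>M\<^esub> top_to_random n"
  have a: "?a \<in> carrier M"
    unfolding M_def by (rule group_algebra_closed[OF group.is_monoid[OF G(1)]])
  have pow: "(?a [^]\<^bsub>M\<^esub> i) \<otimes>\<^bsub>M\<^esub> pull n F = pull n ((rev_shuffle ^^ i) F)" for i :: nat
  proof (induction i arbitrary: F)
    case 0
    have "pull n F \<in> carrier M" unfolding M_def by (rule pull_closed)
    then show ?case by simp
  next
    case (Suc i)
    have "(?a [^]\<^bsub>M\<^esub> Suc i) \<otimes>\<^bsub>M\<^esub> pull n F = (?a [^]\<^bsub>M\<^esub> i) \<otimes>\<^bsub>M\<^esub> (?a \<otimes>\<^bsub>M\<^esub> pull n F)"
      using a M.nat_pow_closed[OF a, of i] pull_closed[of n F] by (simp add: M.m_assoc M_def[symmetric])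
    then show ?case
      using shuffle_mult_pull[OF assms(2), of F] Suc.IH by (simp add: M_def[symmetric] funpow_swap1)
  qed
  show ?thesis
  proof
    fix g
    show "(alg_eval M p ?a \<otimes>\<^bsub>M\<^esub> pull n F) g = pull n (shuffle_eval p F) g"
    proof (cases "g \<in> carrier (sym_group n)")
      case True
      have "(alg_eval M p ?a \<otimes>\<^bsub>M\<^esub> pull n F) g
          = (\<Sum>i\<le>degree p. coeff p i * ((?a [^]\<^bsub>M\<^esub> i) \<otimes>\<^bsub>M\<^esub> pull n F) g)"
        using alg_eval_mult_apply[OF G a[unfolded M_def] True] unfolding M_def .
      then show ?thesis
        unfolding pow using True by (simp add: pull_def sym_group_carrier shuffle_eval_def del: upt_Suc)
    next
      case False
      then show ?thesis unfolding M_def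
        by (simp add: pull_def group_algebra_mult_outside group.is_monoid[OF G(1)] sym_group_carrier)
    qed
  qed
qed

text \<open>Presents the unit of the group algebra as coming from a polynomial, so that an identity
  for T on words becomes one in the algebra.\<close>

lemma pull_identity_word:
  "pull n (\<lambda>u. if u = [1..<Suc n] then 1 else 0) = basis_elem id"
proof
  fix g :: "nat \<Rightarrow> nat"
  have "map (inv' g) [1..<Suc n] = [1..<Suc n] \<longleftrightarrow> g = id" if g: "g permutes {1..n}"
  proof
    assume "map (inv' g) [1..<Suc n] = [1..<Suc n]"
    then have "map (inv' g) [1..<Suc n] = map id [1..<Suc n]" by (simp only: list.map_id)
    then have "inv' g j = j" if "j \<in> {1..n}" for j
      using that unfolding map_eq_conv by (simp del: upt_Suc)
    moreover have "inv' g j = j" if "j \<notin> {1..n}" for j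
      using permutes_inv[OF g] that by (rule permutes_not_in)
    ultimately have "inv' g = id" by (auto simp: fun_eq_iff)
    then show "g = id" using g by (metis inv_id permutes_inv_inv)
  qed simp
  then show "pull n (\<lambda>u. if u = [1..<Suc n] then 1 else 0) g = basis_elem id g"
    by (auto simp: pull_def basis_elem_def permutes_id simp del: upt_Suc)
qed

text \<open>A word using each of 1, ..., n once is the value list of a permutation, so
  \<open>pull n\<close> loses no coefficient of a multilinear polynomial.\<close>

lemma pull_eq_zeroD:
  assumes "F \<in> homog_content (mset (descending n))" "pull n F = (\<lambda>_. 0)"
  shows "F = (\<lambda>_. 0)"
proof
  fix u
  show "F u = 0"
  proof (cases "mset u = mset (descending n)")
    case True
    have len: "length (descending k) = k" and dist: "distinct (descending k)" for k
      by (induction k) (auto simp: set_descending)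
    have u: "distinct u" "set u = {1..n}" "length u = n"
      using True dist[of n] len[of n] set_descending[of n]
      by (metis mset_eq_imp_distinct_iff, metis mset_eq_setD, metis mset_eq_length)
    define v where "v = (\<lambda>j. if j \<in> {1..n} then u ! (j - 1) else j)"
    have "inj_on v {1..n}"
      using u by (auto simp: v_def inj_on_def nth_eq_iff_index_eq)
    moreover have "v ` {1..n} \<subseteq> {1..n}"
    proof
      fix y assume "y \<in> v ` {1..n}"
      then obtain j where j: "j \<in> {1..n}" "y = u ! (j - 1)" by (auto simp: v_def)
      then have "y \<in> set u" using u(3) by auto
      then show "y \<in> {1..n}" by (simp only: u(2))
    qed
    ultimately have "bij_betw v {1..n} {1..n}"
      by (simp add: bij_betw_def endo_inj_surj)
    then have v: "v permutes {1..n}"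
      by (rule bij_imp_permutes) (auto simp: v_def)
    have w: "map v [1..<Suc n] = u"
      by (rule nth_equalityI) (auto simp: v_def u simp del: upt_Suc)
    have "pull n F (inv' v) = F u"
      unfolding pull_def permutes_inv_inv[OF v] w using permutes_inv[OF v] by simp
    then show ?thesis using assms(2) by simp
  next
    case False
    then show ?thesis by (rule homog_contentD[OF assms(1)])
  qed
qed

lemma homog_content_shuffle_eval:
  "F \<in> homog_content M \<Longrightarrow> shuffle_eval p F \<in> homog_content M"
proof (induction p arbitrary: F)
  case 0
  then show ?case by (simp add: homog_content_def)
next
  case (pCons c p)
  have "rev_shuffle F \<in> homog_content M"
  proof (rule homog_contentI, rule ccontr)
    fix u assume u: "mset u \<noteq> M" "rev_shuffle F u \<noteq> 0"
    obtain v where "mset v = mset u" "F v \<noteq> 0" using rev_shuffle_nonzero[OF u(2)] by blast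
    then show False using homog_contentD[OF pCons.prems, of v] u(1) by simp
  qed
  then have "shuffle_eval p (rev_shuffle F) \<in> homog_content M" by (rule pCons.IH)
  then show ?case
    unfolding shuffle_eval_pCons
    by (intro homog_contentI) (simp add: homog_contentD[OF pCons.prems] homog_contentD)
qed

section \<open>The minimal polynomial\<close>

text \<open>An annihilating \<open>q\<close> gives q(T) F = 0 for the eigenvector \<open>F\<close>
  of \<open>k\<close> modulo the filtration, while q(T) F is congruent to q(k) F.\<close>

lemma annihilator_root:
  fixes q :: "'k::field poly" and n :: nat
  defines "M \<equiv> group_algebra (sym_group n) :: ('k, (nat \<Rightarrow> nat) \<Rightarrow> 'k) module"
  assumes n: "n > 1" and k: "k \<in> L n"
    and q: "alg_eval M q (basis_elem (w0 n) \<otimes>\<^bsub>M\<^esub> top_to_random n) = \<zero>\<^bsub>M\<^esub>"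
  shows "poly q (of_int k) = 0"
proof (rule ccontr)
  assume nz: "poly q (of_int k) \<noteq> 0"
  obtain e j and F :: "nat list \<Rightarrow> 'k" where F: "F \<in> signed_filt e j" "F \<notin> deriv_filt j"
      "F \<in> homog_content (mset (descending n))" and ej: "e * of_nat j = of_int k"
    using eigenvector_mod_filt_exists[OF n k] by blast
  have "pull n (shuffle_eval q F) = \<zero>\<^bsub>M\<^esub> \<otimes>\<^bsub>M\<^esub> pull n F"
    using alg_eval_mult_pull[of n q F] n q by (simp add: M_def[symmetric])
  also have "\<dots> = (\<lambda>_. 0)"
    unfolding M_def by (auto simp: fun_eq_iff group_algebra_def)
  finally have "shuffle_eval q F = (\<lambda>_. 0)"
    by (rule pull_eq_zeroD[OF homog_content_shuffle_eval[OF F(3)]])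
  then have "(\<lambda>u. 0 - poly q (of_int k) * F u) \<in> deriv_filt j"
    using shuffle_eval_signed_filt[OF F(1), of q] by (simp add: ej)
  \<comment> \<open>Dividing by the nonzero value of \<open>q\<close> would put \<open>F\<close>
    into \<open>deriv_filt j\<close>.\<close>
  from deriv_filt_lin[OF this this, of "- inverse (poly q (of_int k))" 0]
  show False using nz F(2) by (simp add: mult.assoc[symmetric])
qed

lemma min_poly_candidate:
  fixes P :: "'k::field_char_0 poly" and n :: nat
  defines "P \<equiv> (\<Prod>k\<in>L n. [:- of_int k, 1:])"
    and "M \<equiv> group_algebra (sym_group n) :: ('k, (nat \<Rightarrow> nat) \<Rightarrow> 'k) module"
  assumes n: "n > 1"
  shows "lead_coeff P = 1"
    and "alg_eval M P (basis_elem (w0 n) \<otimes>\<^bsub>M\<^esub> top_to_random n) = \<zero>\<^bsub>M\<^esub>"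
    and "lead_coeff q = 1 \<Longrightarrow> alg_eval M q (basis_elem (w0 n) \<otimes>\<^bsub>M\<^esub> top_to_random n) = \<zero>\<^bsub>M\<^esub>
      \<Longrightarrow> degree P \<le> degree q"
proof -
  have G: "group (sym_group n)" "finite (carrier (sym_group n))"
    by (simp_all add: sym_group_is_group finite_sym_group)
  interpret M: monoid M unfolding M_def by (rule group_algebra_monoid[OF G])
  let ?a = "basis_elem (w0 n) \<otimes>\<^bsub>M\<^esub> top_to_random n"
  have a: "?a \<in> carrier M"
    unfolding M_def by (rule group_algebra_closed[OF group.is_monoid[OF G(1)]])
  show "lead_coeff P = 1" unfolding P_def lead_coeff_prod by simp
  let ?F = "(\<lambda>u. if u = [1..<Suc n] then 1 else 0) :: nat list \<Rightarrow> 'k"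
  have F: "?F \<in> homog n" by (auto simp: homog_def simp del: upt_Suc)
  have "alg_eval M P ?a = alg_eval M P ?a \<otimes>\<^bsub>M\<^esub> \<one>\<^bsub>M\<^esub>"
    using alg_eval_closed[OF G a[unfolded M_def], of P] unfolding M_def[symmetric] by simp
  also have "\<one>\<^bsub>M\<^esub> = pull n ?F"
    unfolding pull_identity_word M_def by (simp add: sym_group_one)
  also have "alg_eval M P ?a \<otimes>\<^bsub>M\<^esub> pull n ?F = pull n (shuffle_eval P ?F)"
    unfolding M_def by (rule alg_eval_mult_pull) (use n in simp)
  also have "\<dots> = \<zero>\<^bsub>M\<^esub>"
    unfolding P_def shuffle_eval_L[OF n F] by (simp add: M_def pull_def fun_eq_iff)
  finally show "alg_eval M P ?a = \<zero>\<^bsub>M\<^esub>" .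
  assume q: "lead_coeff q = 1" "alg_eval M q ?a = \<zero>\<^bsub>M\<^esub>"
  have fin: "finite (L n)" unfolding L_eq_layers[OF n] by simp
  have "q \<noteq> 0" using q(1) by auto
  have "degree P = card (L n)"
    unfolding P_def by (subst degree_prod_sum_eq) auto
  \<comment> \<open>In characteristic 0 the elements of \<open>L n\<close> stay distinct in the
    field, so they are that many roots of \<open>q\<close>.\<close>
  also have "\<dots> = card ((of_int :: int \<Rightarrow> 'k) ` L n)"
    by (rule card_image[symmetric]) (simp add: inj_on_def)
  also have "\<dots> \<le> card {x. poly q x = 0}"
    using annihilator_root[OF n _ q(2)[unfolded M_def]] poly_roots_finite[OF \<open>q \<noteq> 0\<close>]
    by (intro card_mono) auto
  also have "\<dots> \<le> degree q" by (rule card_poly_roots_bound[OF \<open>q \<noteq> 0\<close>])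
  finally show "degree P \<le> degree q" .
qed

text \<open>As W W = 1, conjugation by W exchanges W A and A W.\<close>

lemma alg_eval_swap_iff:
  fixes p :: "'k::field poly" and n :: nat
  defines "M \<equiv> group_algebra (sym_group n) :: ('k, (nat \<Rightarrow> nat) \<Rightarrow> 'k) module"
  shows "alg_eval M p (top_to_random n \<otimes>\<^bsub>M\<^esub> basis_elem (w0 n)) = \<zero>\<^bsub>M\<^esub>
    \<longleftrightarrow> alg_eval M p (basis_elem (w0 n) \<otimes>\<^bsub>M\<^esub> top_to_random n) = \<zero>\<^bsub>M\<^esub>"
proof -
  have G: "group (sym_group n)" "finite (carrier (sym_group n))"
    by (simp_all add: sym_group_is_group finite_sym_group)
  interpret M: monoid M unfolding M_def by (rule group_algebra_monoid[OF G])
  have w: "w0 n \<in> carrier (sym_group n)" "w0 n \<otimes>\<^bsub>sym_group n\<^esub> w0 n = \<one>\<^bsub>sym_group n\<^esub>"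
    by (simp_all add: sym_group_carrier w0_permutes sym_group_mult sym_group_one w0_w0 del: One_nat_def)
  define W where "W = (basis_elem (w0 n) :: _ \<Rightarrow> 'k)"
  define A where "A = (top_to_random n :: _ \<Rightarrow> 'k)"
  have W: "W \<in> carrier M" using w by (auto simp: M_def W_def basis_elem_def)
  have A: "A \<in> carrier M" unfolding A_def M_def by (rule top_to_random_closed)
  have WW: "W \<otimes>\<^bsub>M\<^esub> W = \<one>\<^bsub>M\<^esub>" unfolding W_def M_def by (rule basis_elem_involution[OF G w])
  then have WWl: "W \<otimes>\<^bsub>M\<^esub> (W \<otimes>\<^bsub>M\<^esub> Y) = Y" if "Y \<in> carrier M" for Y
    using that W by (simp add: M.m_assoc[symmetric])
  have conj: "alg_eval M p (W \<otimes>\<^bsub>M\<^esub> X \<otimes>\<^bsub>M\<^esub> W) = \<zero>\<^bsub>M\<^esub>"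
    if "X \<in> carrier M" "alg_eval M p X = \<zero>\<^bsub>M\<^esub>" for X
    using alg_eval_conj[OF G w that[unfolded M_def]] unfolding M_def W_def .
  have "W \<otimes>\<^bsub>M\<^esub> (W \<otimes>\<^bsub>M\<^esub> A) \<otimes>\<^bsub>M\<^esub> W = A \<otimes>\<^bsub>M\<^esub> W" "W \<otimes>\<^bsub>M\<^esub> (A \<otimes>\<^bsub>M\<^esub> W) \<otimes>\<^bsub>M\<^esub> W = W \<otimes>\<^bsub>M\<^esub> A"
    using W A WW by (simp_all add: WWl M.m_assoc)
  then show ?thesis
    using conj[of "W \<otimes>\<^bsub>M\<^esub> A"] conj[of "A \<otimes>\<^bsub>M\<^esub> W"] W A unfolding W_def[symmetric] A_def[symmetric]
    by auto
qed

theorem theorem9p5: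
  fixes n :: nat
    and A W :: "(nat \<Rightarrow> nat) \<Rightarrow> 'k::field_char_0"
    and P :: "'k poly"
  assumes "n > 1"
  defines "A \<equiv> top_to_random n"
    and "W \<equiv> basis_elem (w0 n)"
    and "P \<equiv> (\<Prod>k\<in>L n. [:- of_int k, 1:])"
  shows "is_min_poly (group_algebra (sym_group n)) (W \<otimes>\<^bsub>group_algebra (sym_group n)\<^esub> A) P
       \<and> is_min_poly (group_algebra (sym_group n)) (A \<otimes>\<^bsub>group_algebra (sym_group n)\<^esub> W) P"
  unfolding is_min_poly_def A_def W_def P_def alg_eval_swap_iff
  using min_poly_candidate[OF assms(1), where 'k = 'k] by blast

end
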